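(* Let $n\mid(q+1)$, let $\delta\ge3$ be odd, and let $b,s,m$ be positive integers with $\gcd(b,n)=1$. Let $t\in\{0,\dots,n-1\}$ and let $i_1<\dots<i_s$ be integers with $m-1+\delta\le i_1$, $i_s\le n-\delta$ and $i_{\ell+1}-i_\ell\ge\delta$ for $\ell=1,\dots,s-1$. Put $$A=\{\alpha^{t},\alpha^{t+b},\dots,\alpha^{t+(m-1)b},\alpha^{t+i_1b},\dots,\alpha^{t+i_sb}\},\qquad B=\{\alpha^{jb}: -\tfrac{\delta-3}{2}\le j\le\tfrac{\delta-1}{2}\}.$$ Suppose $\{j:\alpha^j\in AB\}$ is a union of $q$-cyclotomic cosets modulo $n$. Let $d_A^{\perp}$ be the minimum distance of the dual of the cyclic code of length $n$ over $\mathbb{F}_{q^2}$ with complete defining set $A$. Then $C_{AB}$ is a cyclic $(d_A^{\perp}-\delta+1,\delta)$-LRC of length $n$ over $\mathbb{F}_q$ with dimension $k=n-m+1-(s+1)(\delta-1)$. Moreover, if $\lceil k/r\rceil=s+1$ where $r=d_A^{\perp}-\delta+1$, then $C_{AB}$ is an optimal $(r,\delta)$-LRC with minimum distance $m+\delta-1$.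
   Context: Let $q$ be a prime power and $n\mid(q+1)$, so the set $R_n$ of all $n$-th roots of unity lies in $\mathbb{F}_{q^2}$; let $\alpha\in\mathbb{F}_{q^2}$ be a primitive $n$-th root of unity. For $A,B\subseteq R_n$, $AB=\{\beta\gamma:\beta\in A,\gamma\in B\}$. For $Z\subseteq R_n$, the cyclic code of length $n$ over $\mathbb{F}_{q^2}$ with complete defining set $Z$ is the ideal generated by $\prod_{\beta\in Z}(x-\beta)$ in $\mathbb{F}_{q^2}[x]/(x^n-1)$; if $\{j:\alpha^j\in Z\}$ is a union of $q$-cyclotomic cosets modulo $n$ (equivalently here, closed under $j\mapsto -j \bmod n$), this polynomial lies in $\mathbb{F}_q[x]$ and $C_Z$ denotes the cyclic code of length $n$ over $\mathbb{F}_q$ it generates (dimension $n-|Z|$). Locality: for a linear code $C\subseteq\mathbb{F}_q^n$ and integers $r\ge1$, $\delta\ge2$, the $i$-th coordinate has $(r,\delta)$-locality if there is $S_i\subseteq\{1,\dots,n\}$ with $i\in S_i$, $|S_i|\le r+\delta-1$ such that the punctured code $C|_{S_i}$ has minimum distance at least $\delta$; $C$ is an $(r,\delta)$-LRC if every coordinate has $(r,\delta)$-locality. An $[n,k,d]$ $(r,\delta)$-LRC is optimal if $d=n-k-(\lceil k/r\rceil-1)(\delta-1)+1$ (always an upper bound on $d$). *)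

theory Defs
  imports Complex_Main "HOL-Computational_Algebra.Polynomial"
begin

text \<open>Ambient field: a finite field type 'a of order q^2 (playing the role of F_{q^2}).
  The subfield F_q is the set of fixed points of the q-Frobenius.
  Words of length n are functions nat => 'a, coordinates 0..n-1, zero elsewhere.\<close>

definition subfield_Fq :: "nat \<Rightarrow> 'a::field set" where
  "subfield_Fq q = {x. x ^ q = x}"

definition prime_power :: "nat \<Rightarrow> bool" where
  "prime_power q \<longleftrightarrow> (\<exists>p e. prime p \<and> e \<ge> 1 \<and> q = p ^ e)"

definition primitive_root_of_unity :: "nat \<Rightarrow> 'a::field \<Rightarrow> bool" where
  "primitive_root_of_unity n a \<longleftrightarrow> a ^ n = 1 \<and> (\<forall>j. 0 < j \<and> j < n \<longrightarrow> a ^ j \<noteq> 1)"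

definition setprod :: "'a::times set \<Rightarrow> 'a set \<Rightarrow> 'a set" where
  "setprod A B = {x * y | x y. x \<in> A \<and> y \<in> B}"

definition union_of_cyclotomic_cosets :: "nat \<Rightarrow> nat \<Rightarrow> 'a::field \<Rightarrow> 'a set \<Rightarrow> bool" where
  "union_of_cyclotomic_cosets q n a Z \<longleftrightarrow>
     (\<forall>j<n. a ^ j \<in> Z \<longrightarrow> a ^ ((q * j) mod n) \<in> Z)"

definition gen_poly :: "'a::field set \<Rightarrow> 'a poly" where
  "gen_poly Z = (\<Prod>\<beta>\<in>Z. [:- \<beta>, 1:])"

definition xn_minus_1 :: "nat \<Rightarrow> 'a::field poly" where
  "xn_minus_1 n = monom 1 n - 1"

definition poly_word :: "nat \<Rightarrow> 'a::zero poly \<Rightarrow> nat \<Rightarrow> 'a" where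
  "poly_word n c = (\<lambda>i. if i < n then coeff c i else 0)"

definition cyclic_code_big :: "nat \<Rightarrow> 'a::field set \<Rightarrow> (nat \<Rightarrow> 'a) set" where
  "cyclic_code_big n Z = {poly_word n ((f * gen_poly Z) mod xn_minus_1 n) | f. True}"

definition cyclic_code_Fq :: "nat \<Rightarrow> nat \<Rightarrow> 'a::field set \<Rightarrow> (nat \<Rightarrow> 'a) set" where
  "cyclic_code_Fq q n Z = {poly_word n ((f * gen_poly Z) mod xn_minus_1 n) | f.
       \<forall>i. coeff f i \<in> subfield_Fq q}"

definition dual_code :: "nat \<Rightarrow> (nat \<Rightarrow> 'a::field) set \<Rightarrow> (nat \<Rightarrow> 'a) set" where
  "dual_code n C = {v. (\<forall>i\<ge>n. v i = 0) \<and> (\<forall>c\<in>C. (\<Sum>i<n. v i * c i) = 0)}"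

definition hamming_dist :: "nat \<Rightarrow> (nat \<Rightarrow> 'a) \<Rightarrow> (nat \<Rightarrow> 'a) \<Rightarrow> nat" where
  "hamming_dist n x y = card {i. i < n \<and> x i \<noteq> y i}"

definition min_dist :: "nat \<Rightarrow> (nat \<Rightarrow> 'a) set \<Rightarrow> nat" where
  "min_dist n C = Min {hamming_dist n x y | x y. x \<in> C \<and> y \<in> C \<and> x \<noteq> y}"

definition puncture :: "(nat \<Rightarrow> 'a::zero) \<Rightarrow> nat set \<Rightarrow> nat \<Rightarrow> 'a" where
  "puncture c S = (\<lambda>i. if i \<in> S then c i else 0)"

definition has_locality :: "nat \<Rightarrow> (nat \<Rightarrow> 'a::zero) set \<Rightarrow> int \<Rightarrow> nat \<Rightarrow> nat \<Rightarrow> bool" where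
  "has_locality n C r \<delta> i \<longleftrightarrow>
     (\<exists>S. S \<subseteq> {..<n} \<and> i \<in> S \<and> int (card S) \<le> r + int \<delta> - 1 \<and>
        (\<forall>x\<in>C. \<forall>y\<in>C. puncture x S \<noteq> puncture y S \<longrightarrow>
             hamming_dist n (puncture x S) (puncture y S) \<ge> \<delta>))"

definition is_LRC :: "nat \<Rightarrow> (nat \<Rightarrow> 'a::zero) set \<Rightarrow> int \<Rightarrow> nat \<Rightarrow> bool" where
  "is_LRC n C r \<delta> \<longleftrightarrow> r \<ge> 1 \<and> \<delta> \<ge> 2 \<and> (\<forall>i<n. has_locality n C r \<delta> i)"

definition optimal_LRC :: "nat \<Rightarrow> nat \<Rightarrow> (nat \<Rightarrow> 'a::zero) set \<Rightarrow> int \<Rightarrow> nat \<Rightarrow> bool" where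
  "optimal_LRC n k C r \<delta> \<longleftrightarrow> is_LRC n C r \<delta> \<and>
     int (min_dist n C) = int n - int k - (\<lceil>real k / real_of_int r\<rceil> - 1) * (int \<delta> - 1) + 1"

definition setA :: "'a::field \<Rightarrow> nat \<Rightarrow> nat \<Rightarrow> nat \<Rightarrow> (nat \<Rightarrow> nat) \<Rightarrow> nat \<Rightarrow> 'a set" where
  "setA \<alpha> t b m i s = {\<alpha> ^ (t + l * b) | l. l < m} \<union> {\<alpha> ^ (t + i l * b) | l. 1 \<le> l \<and> l \<le> s}"

definition setB :: "'a::field \<Rightarrow> nat \<Rightarrow> nat \<Rightarrow> 'a set" where
  "setB \<alpha> b \<delta> = {\<alpha> powi (j * int b) | j. - ((int \<delta> - 3) div 2) \<le> j \<and> j \<le> (int \<delta> - 1) div 2}"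

end

theory Submission
  imports Defs "HOL-Computational_Algebra.Primes" "HOL-Library.FuncSet"
begin

text \<open>With \<open>g = \<alpha> ^ b\<close>, the set \<open>B\<close> consists of \<open>\<delta> - 1\<close> consecutive powers of \<open>g\<close>. If \<open>u\<close> is a word of
  minimum weight in the dual of the code with defining set \<open>A\<close>, then for every \<open>x\<close> in \<open>C\<^sub>A\<^sub>B\<close> the
  pointwise product of \<open>u\<close> and \<open>x\<close> vanishes at \<open>B\<close>, so by the BCH bound the support of \<open>u\<close> is a
  repair group; cyclic shifts of \<open>u\<close> reach every coordinate. The exponents of \<open>AB\<close> form one run of
  length \<open>m + \<delta> - 2\<close> and \<open>s\<close> disjoint runs of length \<open>\<delta> - 1\<close>, which gives the dimension, and the
  BCH bound on the long run gives \<open>d \<ge> m + \<delta> - 1\<close>. When \<open>\<lceil>k / r\<rceil> = s + 1\<close> this equals the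
  Singleton-type upper bound for locally repairable codes, which follows by counting.\<close>

section \<open>Finite fields\<close>

text \<open>Multiplication by a nonzero \<open>x\<close> permutes the nonzero elements; comparing
  their product before and after cancels to \<open>x ^ (card UNIV - 1) = 1\<close>.\<close>

lemma finite_field_power_card:
  fixes x :: "'a::{finite, field}"
  shows "x ^ card (UNIV :: 'a set) = x"
proof (cases "x = 0")
  case False
  let ?P = "\<Prod>y\<in>UNIV - {0 :: 'a}. y"
  have "?P = (\<Prod>y\<in>UNIV - {0}. x * y)"
    by (rule prod.reindex_bij_witness[of _ "\<lambda>y. x * y" "\<lambda>y. y / x"]) (use False in auto)
  also have "\<dots> = x ^ (card (UNIV :: 'a set) - 1) * ?P"
    by (simp add: prod.distrib)
  finally have "x ^ (card (UNIV :: 'a set) - 1) = 1"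
    by simp
  then have "x * x ^ (card (UNIV :: 'a set) - 1) = x"
    by simp
  then show ?thesis
    using finite_UNIV_card_ge_0[where ?'a = 'a] by (simp add: power_eq_if)
qed (use finite_UNIV_card_ge_0[where ?'a = 'a] in auto)

text \<open>Translation by \<open>1\<close> permutes the field, so the sum of all elements absorbs
  \<open>card UNIV\<close> copies of \<open>1\<close>. This ties the characteristic to the order of
  the field.\<close>

lemma of_nat_card_UNIV_eq_0: "of_nat (card (UNIV :: 'a set)) = (0 :: 'a::{finite, field})"
proof -
  have "(\<Sum>x\<in>UNIV. x :: 'a) = (\<Sum>x\<in>UNIV. x + 1)"
    by (rule sum.reindex_bij_witness[of _ "\<lambda>x. x + 1" "\<lambda>x. x - 1"]) auto
  then show ?thesis
    by (simp add: sum.distrib)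
qed

text \<open>The characteristic is a prime dividing a power of \<open>p\<close>, hence
  \<open>p\<close> itself; so \<open>q\<close> is a power of the characteristic and the freshman's
  dream applies.\<close>

lemma frobenius_sum:
  fixes f :: "'b \<Rightarrow> 'a::{finite, field}"
  assumes "prime_power q" and "card (UNIV :: 'a set) = q ^ 2"
  shows "sum f S ^ q = (\<Sum>x\<in>S. f x ^ q)"
proof -
  obtain p e where pe: "prime p" "e \<ge> 1" "q = p ^ e"
    using assms(1) unfolding prime_power_def by auto
  have pr: "prime CHAR('a)"
    using finite_imp_CHAR_pos[where ?'a = 'a] prime_CHAR_semidom[where ?'a = 'a] by simp
  have "CHAR('a) dvd p ^ (e * 2)"
    using of_nat_card_UNIV_eq_0[where ?'a = 'a] assms(2) pe(3) 
    by (metis of_nat_eq_0_iff_char_dvd power_mult)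
  then have "CHAR('a) = p"
    using pr pe(1) prime_dvd_power primes_dvd_imp_eq by blast
  then show ?thesis
    using freshmans_dream_sum'[OF pr, of q e f S] pe(3) by simp
qed

lemma frobenius_add:
  fixes x y :: "'a::{finite, field}"
  assumes "prime_power q" and "card (UNIV :: 'a set) = q ^ 2"
  shows "(x + y) ^ q = x ^ q + y ^ q"
  using frobenius_sum[OF assms, of "\<lambda>b. if b then x else y" UNIV] by (simp add: UNIV_bool add.commute)

lemma frobenius_minus:
  fixes x :: "'a::{finite, field}"
  assumes "prime_power q" and "card (UNIV :: 'a set) = q ^ 2" 
  shows "(- x) ^ q = - (x ^ q)"
proof -
  have "q > 0"
    using assms(2) finite_UNIV_card_ge_0[where ?'a = 'a] by (auto intro: gr0I)
  then show ?thesis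
    using frobenius_add[OF assms, of x "- x"] by (simp add: power_0_left eq_neg_iff_add_eq_0 add.commute)
qed

lemma prime_power_gt_1: "prime_power q \<Longrightarrow> q > 1"
  unfolding prime_power_def by (metis One_nat_def Suc_le_eq one_less_power prime_gt_1_nat)

lemma subfield_Fq_closed:
  fixes x y :: "'a::{finite, field}"
  assumes "prime_power q" and "card (UNIV :: 'a set) = q ^ 2"
    and "x \<in> subfield_Fq q" and "y \<in> subfield_Fq q"
  shows "x + y \<in> subfield_Fq q" and "x - y \<in> subfield_Fq q" and "x * y \<in> subfield_Fq q"
  using assms(3,4) frobenius_add[OF assms(1,2), of x y] frobenius_add[OF assms(1,2), of x "- y"]
    frobenius_minus[OF assms(1,2), of y]
  by (simp_all add: subfield_Fq_def power_mult_distrib)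

lemma zero_in_subfield_Fq: "prime_power q \<Longrightarrow> 0 \<in> subfield_Fq q"
  using prime_power_gt_1[of q] by (simp add: subfield_Fq_def)

section \<open>Cardinality of the subfield\<close>

lemma card_roots_power_eq_1_le:
  assumes "N > 0"
  shows "card {x :: 'a::field. x ^ N = 1} \<le> N" and "finite {x :: 'a::field. x ^ N = 1}"
proof -
  let ?P = "monom (1 :: 'a) N - 1"
  have "coeff ?P N = 1"
    using assms by simp
  then have nz: "?P \<noteq> 0"
    by (metis coeff_0 zero_neq_one)
  have eq: "{x. poly ?P x = 0} = {x. x ^ N = 1}"
    by (simp add: poly_monom)
  have "degree ?P \<le> N"
    by (rule degree_diff_le) (simp_all add: degree_monom_le)
  with card_poly_roots_bound[OF nz] eq show "card {x :: 'a. x ^ N = 1} \<le> N"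
    by simp
  show "finite {x :: 'a. x ^ N = 1}"
    using poly_roots_finite[OF nz] eq by simp
qed

text \<open>The nonzero elements split into the roots of \<open>X ^ (q - 1) - 1\<close> and the roots of the
  cofactor of that polynomial in \<open>X ^ (q\<^sup>2 - 1) - 1\<close>; both sets attain their degree bounds.\<close>
lemma card_subfield_Fq:
  assumes "prime_power q" and "card (UNIV :: 'a::{finite, field} set) = q ^ 2"
  shows "card (subfield_Fq q :: 'a set) = q"
proof -
  have q1: "q > 1"
    using assms(1) by (rule prime_power_gt_1)
  define Q :: "'a poly" where "Q = (\<Sum>j<q + 1. monom 1 ((q - 1) * j))"
  define R where "R = {x :: 'a. x ^ (q - 1) = 1}"
  have qq: "(q - 1) * (q + 1) = q ^ 2 - 1"
    using q1 by (simp add: power2_eq_square algebra_simps diff_mult_distrib)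
  \<comment> \<open>As \<open>q - 1 > 0\<close>, the exponents \<open>(q - 1) * j\<close> are
    distinct, so only \<open>j = q\<close> contributes.\<close>
  have "coeff Q ((q - 1) * q) = (\<Sum>j<q + 1. if j = q then 1 else 0)"
    unfolding Q_def coeff_sum using q1 by (intro sum.cong) auto
  also have "\<dots> = 1"
    by simp
  finally have Q0: "Q \<noteq> 0"
    by auto
  have dQ: "degree Q \<le> (q - 1) * q"
    unfolding Q_def
    by (rule degree_sum_le) (auto intro!: order.trans[OF degree_monom_le])
  have cover: "UNIV - {0} \<subseteq> R \<union> {x. poly Q x = 0}"
  proof
    fix x :: 'a
    assume x: "x \<in> UNIV - {0}"
    have "x * x ^ (q ^ 2 - 1) = x"
      using finite_field_power_card[of x] assms(2) q1 by (simp add: power_eq_if)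
    then have "x ^ (q ^ 2 - 1) = 1"
      using x by simp
    then have "(x ^ (q - 1)) ^ (q + 1) - 1 = 0"
      by (simp only: power_mult[symmetric] qq) simp
    also have "(x ^ (q - 1)) ^ (q + 1) - 1 = (x ^ (q - 1) - 1) * (\<Sum>j<q + 1. (x ^ (q - 1)) ^ j)"
      by (rule power_diff_1_eq)
    also have "(\<Sum>j<q + 1. (x ^ (q - 1)) ^ j) = poly Q x"
      by (simp add: Q_def poly_sum poly_monom power_mult)
    finally show "x \<in> R \<union> {x. poly Q x = 0}"
      by (auto simp: R_def)
  qed
  have "q ^ 2 - 1 = card (UNIV - {0 :: 'a})"
    using assms(2) by simp
  also have "\<dots> \<le> card (R \<union> {x. poly Q x = 0})"
    by (rule card_mono[OF _ cover]) simp
  also have "\<dots> \<le> card R + card {x. poly Q x = 0}"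
    by (rule card_Un_le)
  also have "\<dots> \<le> card R + (q - 1) * q"
    using card_poly_roots_bound[OF Q0] dQ by linarith
  \<comment> \<open>Of the \<open>(q - 1) * (q + 1)\<close> nonzero elements at most
    \<open>(q - 1) * q\<close> are roots of \<open>Q\<close>.\<close>
  finally have "card R \<ge> q - 1"
    using qq by (simp only: distrib_left mult_1_right)
  moreover have "card R \<le> q - 1"
    unfolding R_def using q1 by (intro card_roots_power_eq_1_le) simp
  moreover have "subfield_Fq q = insert 0 R"
  proof (intro set_eqI)
    fix x :: 'a
    have "x ^ q = x * x ^ (q - 1)"
      using q1 by (simp add: power_eq_if)
    then show "x \<in> subfield_Fq q \<longleftrightarrow> x \<in> insert 0 R"
      using q1 by (auto simp: subfield_Fq_def R_def)
  qed
  moreover have "0 \<notin> R"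
    using q1 by (simp add: R_def power_0_left)
  ultimately show ?thesis
    using q1 by simp
qed

section \<open>The BCH bound\<close>

text \<open>Interpolation in place of a Vandermonde determinant: the polynomial whose roots are all
  nodes but \<open>x l\<close> has degree \<open>card T - 1 < N\<close>, so its weighted sum over
  the nodes is a combination of vanishing power sums, yet only the term at \<open>l\<close>
  survives.\<close>

lemma power_sums_zero_imp_zero:
  fixes x w :: "'b \<Rightarrow> 'a::field"
  assumes "finite T" and "inj_on x T" and "card T \<le> N"
    and sums: "\<And>j. j < N \<Longrightarrow> (\<Sum>i\<in>T. w i * x i ^ j) = 0"
    and "l \<in> T"
  shows "w l = 0"
proof -
  define P where "P = (\<Prod>i\<in>T - {l}. [:- x i, 1:])"
  have "degree P = card (T - {l})"
    unfolding P_def by (subst degree_prod_eq_sum_degree) auto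
  then have deg: "degree P < N"
    using assms(1,3,5) by (metis card_Diff1_less dual_order.strict_trans1)
  have "(\<Sum>i\<in>T. w i * poly P (x i)) = (\<Sum>i\<in>T. \<Sum>j\<le>degree P. coeff P j * (w i * x i ^ j))"
    by (simp add: poly_altdef sum_distrib_left mult_ac)
  also have "\<dots> = (\<Sum>j\<le>degree P. coeff P j * (\<Sum>i\<in>T. w i * x i ^ j))"
    by (subst sum.swap) (simp add: sum_distrib_left)
  also have "\<dots> = 0"
    using deg by (intro sum.neutral) (auto simp: sums)
  finally have "0 = (\<Sum>i\<in>T. w i * poly P (x i))"
    by simp
  also have "\<dots> = (\<Sum>i\<in>{l}. w i * poly P (x i))"
    using assms(1,5) by (intro sum.mono_neutral_right) (auto simp: P_def poly_prod)
  finally have "w l * poly P (x l) = 0"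
    by simp
  moreover have "poly P (x l) \<noteq> 0"
    using assms(1,2,5) by (auto simp: P_def poly_prod inj_on_def)
  ultimately show ?thesis
    by simp
qed

section \<open>Primitive roots of unity and consecutive roots of a word\<close>

lemma primitive_root_nonzero:
  assumes "primitive_root_of_unity n g" and "n > 0"
  shows "g \<noteq> 0"
  using assms by (auto simp: primitive_root_of_unity_def power_0_left)

lemma primitive_root_inj_on:
  assumes "primitive_root_of_unity n (g :: 'a::field)" and "n > 0"
  shows "inj_on (\<lambda>e. g ^ e) {..<n}"
proof -
  have neq: "g ^ x \<noteq> g ^ y" if "x < y" "y < n" for x y
  proof
    assume eq: "g ^ x = g ^ y"
    have "g ^ y = g ^ x * g ^ (y - x)"
      using that by (simp flip: power_add)
    then have "g ^ (y - x) = 1"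
      using eq primitive_root_nonzero[OF assms] by simp
    then show False
      using that assms(1) by (auto simp: primitive_root_of_unity_def)
  qed
  then show ?thesis
    by (intro inj_onI) (metis lessThan_iff linorder_neqE_nat)
qed

lemma power_mod_order:
  assumes "(x :: 'a::field) ^ n = 1"
  shows "x ^ (e mod n) = x ^ e"
proof -
  have "x ^ e = x ^ (n * (e div n) + e mod n)"
    by simp
  also have "\<dots> = x ^ (e mod n)"
    by (simp only: power_add power_mult assms) simp
  finally show ?thesis ..
qed

lemma primitive_root_power_coprime:
  assumes "primitive_root_of_unity n (g :: 'a::field)" and "n > 0" and "gcd b n = 1"
  shows "primitive_root_of_unity n (g ^ b)"
  unfolding primitive_root_of_unity_def
proof (intro conjI allI impI)
  have gn: "g ^ n = 1"
    using assms(1) by (simp add: primitive_root_of_unity_def)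
  show "(g ^ b) ^ n = 1"
    by (metis gn mult.commute power_mult power_one)
  fix j
  assume j: "0 < j \<and> j < n"
  show "(g ^ b) ^ j \<noteq> 1"
  proof
    assume "(g ^ b) ^ j = 1"
    then have "g ^ ((b * j) mod n) = 1"
      by (simp add: power_mod_order[OF gn] power_mult)
    then have "(b * j) mod n = 0"
      using assms(1,2) by (metis bot_nat_0.not_eq_extremum mod_less_divisor primitive_root_of_unity_def)
    then have "n dvd j"
      using assms(3) by (metis coprime_commute coprime_dvd_mult_right_iff coprime_iff_gcd_eq_1 mod_0_imp_dvd)
    then show False
      using j by (auto dest: dvd_imp_le)
  qed
qed

text \<open>With a support of size at most \<open>N\<close>, the weights \<open>z i * c ^ i\<close>
  at the distinct nodes \<open>g ^ i\<close> would have \<open>N\<close> vanishing power sums and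
  hence all be zero. The factor \<open>c\<close> lets the run of roots start anywhere.\<close>

lemma BCH_bound:
  fixes z :: "nat \<Rightarrow> 'a::field"
  assumes g: "primitive_root_of_unity n g" and "n > 0" and "c \<noteq> 0"
    and roots: "\<And>j. j < N \<Longrightarrow> (\<Sum>i<n. z i * (c * g ^ j) ^ i) = 0"
    and nonzero: "l < n" "z l \<noteq> 0"
  shows "card {i. i < n \<and> z i \<noteq> 0} \<ge> N + 1"
proof (rule ccontr)
  let ?T = "{i. i < n \<and> z i \<noteq> 0}"
  assume "\<not> ?thesis"
  then have "card ?T \<le> N"
    by simp
  moreover have "inj_on (\<lambda>i. g ^ i) ?T"
    using primitive_root_inj_on[OF g assms(2)] by (rule inj_on_subset) auto
  moreover have "(\<Sum>i\<in>?T. (z i * c ^ i) * (g ^ i) ^ j) = 0" if "j < N" for j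
  proof -
    have "(\<Sum>i\<in>?T. (z i * c ^ i) * (g ^ i) ^ j) = (\<Sum>i\<in>?T. z i * (c * g ^ j) ^ i)"
      by (intro sum.cong) (simp_all add: power_mult_distrib mult.commute flip: power_mult)
    also have "\<dots> = (\<Sum>i<n. z i * (c * g ^ j) ^ i)"
      by (intro sum.mono_neutral_left) auto
    finally show ?thesis
      using roots[OF that] by simp
  qed
  ultimately have "z l * c ^ l = 0"
    using nonzero by (intro power_sums_zero_imp_zero[of ?T "\<lambda>i. g ^ i" N "\<lambda>i. z i * c ^ i"]) auto
  then show False
    using nonzero assms(3) by simp
qed

section \<open>Cyclic codes\<close>

lemma xn_minus_1_degree:
  assumes "n > 0"
  shows "degree (xn_minus_1 n :: 'a::field poly) = n" and "xn_minus_1 n \<noteq> (0 :: 'a poly)"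
proof -
  have c: "coeff (xn_minus_1 n :: 'a poly) n = 1"
    using assms by (simp add: xn_minus_1_def)
  then show "xn_minus_1 n \<noteq> (0 :: 'a poly)"
    by (metis coeff_0 zero_neq_one)
  have "degree (xn_minus_1 n :: 'a poly) \<le> n"
    unfolding xn_minus_1_def by (rule degree_diff_le) (simp_all add: degree_monom_le)
  then show "degree (xn_minus_1 n :: 'a poly) = n"
    using c by (metis le_antisym le_degree zero_neq_one)
qed

lemma poly_mod_xn_minus_1:
  assumes "x ^ n = (1 :: 'a::field)"
  shows "poly (p mod xn_minus_1 n) x = poly p x"
proof -
  have "poly p x = poly (p div xn_minus_1 n * xn_minus_1 n + p mod xn_minus_1 n) x"
    by simp
  also have "\<dots> = poly (p mod xn_minus_1 n) x"
    using assms by (simp only: poly_add poly_mult) (simp add: xn_minus_1_def poly_monom)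
  finally show ?thesis ..
qed

text \<open>Inverse to \<open>poly_word\<close> on words that vanish from position \<open>n\<close>
  on; it makes codewords divisible by the generator polynomial in the literal sense.\<close>

definition word_poly :: "nat \<Rightarrow> (nat \<Rightarrow> 'a::field) \<Rightarrow> 'a poly" where
  "word_poly n c = (\<Sum>i<n. monom (c i) i)"

lemma coeff_word_poly: "coeff (word_poly n c) i = (if i < n then c i else 0)"
proof -
  have "coeff (word_poly n c) i = (\<Sum>j<n. if j = i then c j else 0)"
    by (simp add: word_poly_def coeff_sum)
  then show ?thesis
    by simp
qed

lemma poly_word_poly: "poly (word_poly n c) x = (\<Sum>i<n. c i * x ^ i)"
  by (simp add: word_poly_def poly_sum poly_monom)

lemma coeff_eq_0_imp_degree_less:
  assumes "n > 0" and "\<And>i. i \<ge> n \<Longrightarrow> coeff p i = 0"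
  shows "degree p < n"
proof -
  have "degree p \<le> n - 1"
    using assms by (intro degree_le) auto
  then show ?thesis
    using assms(1) by linarith
qed

lemma degree_word_poly: "n > 0 \<Longrightarrow> degree (word_poly n c) < n"
  by (intro coeff_eq_0_imp_degree_less) (simp_all add: coeff_word_poly)

lemma poly_eq_sum_lessThan:
  fixes p :: "'a::field poly"
  assumes "degree p < n"
  shows "poly p x = (\<Sum>i<n. coeff p i * x ^ i)"
  unfolding poly_altdef using assms
  by (intro sum.mono_neutral_left) (auto intro: coeff_eq_0)

lemma gen_poly_degree:
  assumes "finite Z"
  shows "degree (gen_poly Z :: 'a::field poly) = card Z" and "gen_poly Z \<noteq> (0 :: 'a poly)"
  unfolding gen_poly_def
  by (subst degree_prod_eq_sum_degree) (use assms in auto)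

lemma gen_poly_dvd_iff:
  assumes "finite Z"
  shows "gen_poly Z dvd (p :: 'a::field poly) \<longleftrightarrow> (\<forall>x\<in>Z. poly p x = 0)"
proof
  assume "gen_poly Z dvd p"
  then obtain f where "p = gen_poly Z * f"
    by auto
  then show "\<forall>x\<in>Z. poly p x = 0"
    using assms by (auto simp: gen_poly_def poly_prod)
next
  show "\<forall>x\<in>Z. poly p x = 0 \<Longrightarrow> gen_poly Z dvd p"
    using assms
  proof (induction Z arbitrary: p rule: finite_induct)
    case (insert z Z)
    then obtain f where f: "p = [:- z, 1:] * f"
      by (metis dvdE insertI1 poly_eq_0_iff_dvd)
    \<comment> \<open>The remaining points differ from \<open>z\<close>, so the linear factor split
      off does not vanish at them.\<close>
    have "\<forall>x\<in>Z. poly f x = 0"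
      using insert.prems insert.hyps(2) f by auto
    then have "gen_poly Z dvd f"
      by (rule insert.IH)
    then show ?case
      using insert.hyps f by (simp add: gen_poly_def mult_dvd_mono del: mult_pCons_left)
  qed (simp add: gen_poly_def)
qed

lemma cyclic_word_roots:
  fixes f :: "'a::field poly"
  assumes "n > 0" and "finite Z" and Z: "\<And>x. x \<in> Z \<Longrightarrow> x ^ n = 1" and "x \<in> Z"
  shows "(\<Sum>i<n. poly_word n ((f * gen_poly Z) mod xn_minus_1 n) i * x ^ i) = 0"
proof -
  let ?p = "(f * gen_poly Z) mod xn_minus_1 n"
  have "degree ?p < n"
    using degree_mod_less[OF xn_minus_1_degree(2)[OF assms(1)], of "f * gen_poly Z"] assms(1)
    by (auto simp: xn_minus_1_degree(1))
  then have "(\<Sum>i<n. poly_word n ?p i * x ^ i) = poly ?p x"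
    by (simp add: poly_eq_sum_lessThan poly_word_def)
  also have "\<dots> = poly (f * gen_poly Z) x"
    using Z assms(4) by (intro poly_mod_xn_minus_1) auto
  also have "\<dots> = 0"
    using assms(2,4) gen_poly_dvd_iff[of Z "f * gen_poly Z"] by auto
  finally show ?thesis .
qed

lemma mod_xn_minus_1_eq_self:
  "n > 0 \<Longrightarrow> degree p < n \<Longrightarrow> (p :: 'a::field poly) mod xn_minus_1 n = p"
  by (simp add: mod_poly_less xn_minus_1_degree)

text \<open>The polynomial of a word has degree below \<open>n\<close>, so reduction modulo
  \<open>xn_minus_1 n\<close> leaves it alone. The quotient \<open>f\<close> is exposed because over
  the subfield its coefficients have to be examined as well.\<close>

lemma word_eq_gen_poly_mult:
  fixes c :: "nat \<Rightarrow> 'a::field"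
  assumes "n > 0" and "finite Z" and "\<forall>i\<ge>n. c i = 0"
    and "\<forall>x\<in>Z. (\<Sum>i<n. c i * x ^ i) = 0"
  shows "\<exists>f. word_poly n c = f * gen_poly Z \<and>
    c = poly_word n ((f * gen_poly Z) mod xn_minus_1 n)"
proof -
  have "gen_poly Z dvd word_poly n c"
    using assms(2,4) by (simp add: gen_poly_dvd_iff poly_word_poly)
  then obtain f where f: "word_poly n c = f * gen_poly Z"
    by (metis dvdE mult.commute)
  have "poly_word n ((f * gen_poly Z) mod xn_minus_1 n) = poly_word n (word_poly n c)"
    using assms(1) degree_word_poly[of n c] by (simp add: f[symmetric] mod_xn_minus_1_eq_self)
  also have "\<dots> = c"
    using assms(3) by (auto simp: poly_word_def coeff_word_poly fun_eq_iff)
  finally show ?thesis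
    using f by metis
qed

text \<open>Replaces the ideal by parity checks, the form in which shifts, duals and products of
  words are handled.\<close>

lemma cyclic_code_big_eq:
  fixes Z :: "'a::field set"
  assumes "n > 0" and "finite Z" and "\<And>x. x \<in> Z \<Longrightarrow> x ^ n = 1"
  shows "cyclic_code_big n Z = {c. (\<forall>i\<ge>n. c i = 0) \<and> (\<forall>x\<in>Z. (\<Sum>i<n. c i * x ^ i) = 0)}"
proof (intro equalityI subsetI)
  fix c
  assume "c \<in> cyclic_code_big n Z"
  then show "c \<in> {c. (\<forall>i\<ge>n. c i = 0) \<and> (\<forall>x\<in>Z. (\<Sum>i<n. c i * x ^ i) = 0)}"
    using cyclic_word_roots[OF assms] by (auto simp: cyclic_code_big_def) (simp add: poly_word_def)
next
  fix c
  assume "c \<in> {c. (\<forall>i\<ge>n. c i = 0) \<and> (\<forall>x\<in>Z. (\<Sum>i<n. c i * x ^ i) = 0)}"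
  then show "c \<in> cyclic_code_big n Z"
    using word_eq_gen_poly_mult[OF assms(1,2), of c] by (simp add: cyclic_code_big_def) blast
qed

section \<open>Descent of polynomials to the subfield\<close>

definition frobenius_poly :: "nat \<Rightarrow> 'a::field poly \<Rightarrow> 'a poly" where
  "frobenius_poly q p = map_poly (\<lambda>c. c ^ q) p"

lemma coeff_frobenius_poly: "q > 0 \<Longrightarrow> coeff (frobenius_poly q p) i = coeff p i ^ q"
  by (simp add: frobenius_poly_def coeff_map_poly)

lemma frobenius_poly_eq_iff:
  "q > 0 \<Longrightarrow> frobenius_poly q p = p \<longleftrightarrow> (\<forall>i. coeff p i \<in> subfield_Fq q)"
  by (simp add: poly_eq_iff coeff_frobenius_poly subfield_Fq_def)

lemma frobenius_poly_mult:
  fixes p p' :: "'a::{finite, field} poly"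
  assumes "prime_power q" and "card (UNIV :: 'a set) = q ^ 2"
  shows "frobenius_poly q (p * p') = frobenius_poly q p * frobenius_poly q p'"
  using prime_power_gt_1[OF assms(1)]
  by (simp add: poly_eq_iff coeff_frobenius_poly coeff_mult frobenius_sum[OF assms] power_mult_distrib)

lemma frobenius_poly_linear:
  fixes x :: "'a::{finite, field}"
  assumes "prime_power q" and "card (UNIV :: 'a set) = q ^ 2"
  shows "frobenius_poly q [:- x, 1:] = [:- (x ^ q), 1:]"
  using prime_power_gt_1[OF assms(1)]
  by (simp add: frobenius_poly_def map_poly_pCons frobenius_minus[OF assms])

text \<open>The map \<open>x ^ q\<close> is an involution of the field of order
  \<open>q ^ 2\<close>, so it permutes the finite set \<open>Z\<close> and only reorders the linear
  factors.\<close>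

lemma frobenius_gen_poly:
  fixes Z :: "'a::{finite, field} set"
  assumes "prime_power q" and "card (UNIV :: 'a set) = q ^ 2"
    and closed: "\<And>x. x \<in> Z \<Longrightarrow> x ^ q \<in> Z"
  shows "frobenius_poly q (gen_poly Z) = gen_poly Z"
proof -
  have inj: "inj_on (\<lambda>x. x ^ q) Z"
  proof (rule inj_on_inverseI)
    show "(x ^ q) ^ q = x" for x :: 'a
      using finite_field_power_card[of x] assms(2) by (simp add: power2_eq_square power_mult)
  qed
  have img: "(\<lambda>x. x ^ q) ` Z = Z"
    using closed inj by (intro endo_inj_surj) auto
  have "frobenius_poly q (\<Prod>x\<in>Y. [:- x, 1:]) = (\<Prod>x\<in>Y. [:- (x ^ q), 1:])" for Y :: "'a set"
  proof (induction Y rule: infinite_finite_induct)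
    case (insert y Y)
    then show ?case
      by (simp add: frobenius_poly_mult[OF assms(1,2)] frobenius_poly_linear[OF assms(1,2)]
          del: mult_pCons_left mult_pCons_right)
  qed (simp_all add: frobenius_poly_def)
  also have "(\<Prod>x\<in>Z. [:- (x ^ q), 1:]) = (\<Prod>x\<in>(\<lambda>x. x ^ q) ` Z. [:- x, 1:])"
    using inj by (simp add: prod.reindex)
  finally show ?thesis
    unfolding img gen_poly_def .
qed

lemma coeff_mult_Fq:
  fixes p p' :: "'a::{finite, field} poly"
  assumes "prime_power q" and "card (UNIV :: 'a set) = q ^ 2"
    and "\<And>i. coeff p i \<in> subfield_Fq q" and "\<And>i. coeff p' i \<in> subfield_Fq q"
  shows "coeff (p * p') i \<in> subfield_Fq q"
  using assms(3,4)
  by (intro coeff_mult_semiring_closed)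
    (simp_all add: subfield_Fq_closed[OF assms(1,2)] zero_in_subfield_Fq[OF assms(1)])

text \<open>Since \<open>xn_minus_1 n\<close> is monic, each step of long division only subtracts
  and adds coefficients of \<open>p\<close>.\<close>

lemma coeff_mod_xn_minus_1_Fq:
  fixes p :: "'a::{finite, field} poly"
  assumes "prime_power q" and "card (UNIV :: 'a set) = q ^ 2" and "n > 0"
    and "\<And>i. coeff p i \<in> subfield_Fq q"
  shows "coeff (p mod xn_minus_1 n) i \<in> subfield_Fq q"
  using assms(4)
proof (induction "degree p" arbitrary: p i rule: less_induct)
  case less
  show ?case
  proof (cases "degree p < n")
    case True
    then show ?thesis
      using less.prems assms(3) by (simp add: mod_xn_minus_1_eq_self)
  next
    case False
    define d where "d = degree p"
    \<comment> \<open>One division step: the leading coefficient moves from degree \<open>d\<close>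
      down to \<open>d - n\<close>, which keeps the remainder and lowers the degree.\<close>
    define p' where "p' = p - monom (lead_coeff p) (d - n) * xn_minus_1 n"
    have d: "d \<ge> n"
      using False by (simp add: d_def)
    have co: "coeff p' j = coeff p j - (if j = d then lead_coeff p else 0)
        + (if j = d - n then lead_coeff p else 0)" for j
      using d by (simp add: p'_def xn_minus_1_def right_diff_distrib mult_monom)
    have "coeff p' j = 0" if "j \<ge> d" for j
    proof (cases "j = d")
      case True
      then show ?thesis
        using d assms(3) by (simp add: co d_def)
    next
      case False
      then have "degree p < j"
        using that by (simp add: d_def)
      then show ?thesis
        using d assms(3) that False by (simp add: co coeff_eq_0)
    qed
    then have deg: "degree p' < degree p"
      using assms(3) d by (simp add: coeff_eq_0_imp_degree_less flip: d_def)
    have "coeff p' j \<in> subfield_Fq q" for j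
      using less.prems by (simp add: co subfield_Fq_closed[OF assms(1,2)] zero_in_subfield_Fq[OF assms(1)])
    then have "coeff (p' mod xn_minus_1 n) i \<in> subfield_Fq q"
      using less.hyps[OF deg] by blast
    moreover have "p' mod xn_minus_1 n = p mod xn_minus_1 n"
      by (simp add: p'_def mod_diff_eq[symmetric])
    ultimately show ?thesis
      by simp
  qed
qed

section \<open>Cyclic codes over the subfield\<close>

locale Fq_cyclic_code =
  fixes q n :: nat and Z :: "'a::{finite, field} set"
  assumes prime_power: "prime_power q" and card_field: "card (UNIV :: 'a set) = q ^ 2"
    and n_pos: "n > 0" and roots_of_unity: "\<And>x. x \<in> Z \<Longrightarrow> x ^ n = 1"
    and frobenius_closed: "\<And>x. x \<in> Z \<Longrightarrow> x ^ q \<in> Z"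
begin

lemma q_pos: "q > 0"
  using prime_power_gt_1[OF prime_power] by simp

lemma coeff_gen_poly_Fq: "coeff (gen_poly Z) i \<in> subfield_Fq q"
  using frobenius_gen_poly[OF prime_power card_field frobenius_closed] q_pos
  by (simp add: frobenius_poly_eq_iff)

text \<open>Applying Frobenius to the product fixes both the product and \<open>gen_poly Z\<close>;
  cancelling the latter shows that \<open>f\<close> is fixed too.\<close>

lemma cofactor_Fq:
  assumes "\<And>i. coeff (f * gen_poly Z) i \<in> subfield_Fq q"
  shows "coeff f i \<in> subfield_Fq q"
proof -
  have "frobenius_poly q f * gen_poly Z = f * gen_poly Z"
    using assms q_pos frobenius_gen_poly[OF prime_power card_field frobenius_closed]
    by (metis frobenius_poly_eq_iff frobenius_poly_mult[OF prime_power card_field])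
  then have "frobenius_poly q f = f"
    using gen_poly_degree(2)[of Z] by simp
  then show ?thesis
    using q_pos by (simp add: frobenius_poly_eq_iff)
qed

text \<open>The ideal over the subfield is the full set of subfield words satisfying the checks: the
  quotient of such a word by the generator has its coefficients in the subfield by
  \<open>cofactor_Fq\<close>.\<close>

lemma cyclic_code_Fq_eq:
  "cyclic_code_Fq q n Z = {c. (\<forall>i. c i \<in> subfield_Fq q) \<and> (\<forall>i\<ge>n. c i = 0) \<and>
     (\<forall>x\<in>Z. (\<Sum>i<n. c i * x ^ i) = 0)}" (is "_ = ?R")
proof (intro equalityI subsetI)
  fix c
  assume "c \<in> cyclic_code_Fq q n Z"
  then obtain f where c: "c = poly_word n ((f * gen_poly Z) mod xn_minus_1 n)"
    and f: "\<And>i. coeff f i \<in> subfield_Fq q"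
    by (auto simp: cyclic_code_Fq_def)
  have "coeff ((f * gen_poly Z) mod xn_minus_1 n) i \<in> subfield_Fq q" for i
    using coeff_gen_poly_Fq f
    by (intro coeff_mod_xn_minus_1_Fq[OF prime_power card_field n_pos]
        coeff_mult_Fq[OF prime_power card_field])
  then have "c i \<in> subfield_Fq q" for i
    by (simp add: c poly_word_def zero_in_subfield_Fq[OF prime_power])
  moreover have "\<forall>i\<ge>n. c i = 0"
    by (simp add: c poly_word_def)
  moreover have "\<forall>x\<in>Z. (\<Sum>i<n. c i * x ^ i) = 0"
    unfolding c using cyclic_word_roots[OF n_pos _ roots_of_unity] by auto
  ultimately show "c \<in> ?R"
    by simp
next
  fix c
  assume c: "c \<in> ?R"
  then obtain f where f: "word_poly n c = f * gen_poly Z"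
    "c = poly_word n ((f * gen_poly Z) mod xn_minus_1 n)"
    using word_eq_gen_poly_mult[OF n_pos, of Z c] by auto
  have "coeff (f * gen_poly Z) i \<in> subfield_Fq q" for i
    using c f(1)[symmetric] by (simp add: coeff_word_poly zero_in_subfield_Fq[OF prime_power])
  then have "coeff f i \<in> subfield_Fq q" for i
    by (rule cofactor_Fq)
  then show "c \<in> cyclic_code_Fq q n Z"
    using f(2) by (auto simp: cyclic_code_Fq_def)
qed

text \<open>Multiplication by the generator polynomial maps the polynomials over the subfield of degree
  below \<open>n - card Z\<close> bijectively onto the code.\<close>
lemma card_cyclic_code_Fq:
  assumes "card Z \<le> n"
  shows "card (cyclic_code_Fq q n Z) = q ^ (n - card Z)"
proof -
  let ?k = "n - card Z" and ?F = "subfield_Fq q :: 'a set"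
  define W where "W = {..<?k} \<rightarrow>\<^sub>E ?F"
  define enc where "enc = (\<lambda>w. coeff (word_poly ?k w * gen_poly Z))"
  have deg: "degree (word_poly ?k w * gen_poly Z) < n" for w
  \<comment> \<open>For \<open>?k = 0\<close> the message polynomial is zero, which the general
    degree estimate cannot treat.\<close>
  proof (cases "?k = 0")
    case True
    then show ?thesis
      using n_pos by (simp add: word_poly_def)
  next
    case False
    have "degree (word_poly ?k w * gen_poly Z) \<le> degree (word_poly ?k w) + card Z"
      using degree_mult_le[of "word_poly ?k w" "gen_poly Z"] by (simp add: gen_poly_degree)
    then show ?thesis
      using degree_word_poly[of ?k w] False by linarith
  qed
  have "inj_on enc W"
  proof (rule inj_onI)
    fix v w
    assume vw: "v \<in> W" "w \<in> W" "enc v = enc w"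
    then have "word_poly ?k v * gen_poly Z = word_poly ?k w * gen_poly Z"
      by (simp add: enc_def coeff_inject)
    then have eq: "word_poly ?k v = word_poly ?k w"
      using gen_poly_degree(2)[of Z] by simp
    have "v i = w i" if "i < ?k" for i
      using arg_cong[OF eq, of "\<lambda>p. coeff p i"] that by (simp add: coeff_word_poly)
    then show "v = w"
      using vw(1,2) unfolding W_def by (intro PiE_ext[of v _ _ w]) auto
  qed
  moreover have "enc ` W = cyclic_code_Fq q n Z"
  proof (intro equalityI subsetI)
    fix c
    assume "c \<in> enc ` W"
    then obtain w where w: "w \<in> W" "c = enc w"
      by auto
    have "coeff (word_poly ?k w) i \<in> ?F" for i
      using w(1) by (auto simp: coeff_word_poly W_def PiE_iff zero_in_subfield_Fq[OF prime_power])
    then have "c i \<in> ?F" for i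
      unfolding w(2) enc_def
      by (intro coeff_mult_Fq[OF prime_power card_field] coeff_gen_poly_Fq)
    moreover have "c i = 0" if "i \<ge> n" for i
      unfolding w(2) enc_def using deg[of w] that by (intro coeff_eq_0) linarith
    moreover have "(\<Sum>i<n. c i * x ^ i) = 0" if "x \<in> Z" for x
    proof -
      have "(\<Sum>i<n. c i * x ^ i) = poly (word_poly ?k w * gen_poly Z) x"
        using poly_eq_sum_lessThan[OF deg, of w x] by (simp add: w(2) enc_def)
      also have "\<dots> = 0"
        using that gen_poly_dvd_iff[of Z "word_poly ?k w * gen_poly Z"] by auto
      finally show ?thesis .
    qed
    ultimately show "c \<in> cyclic_code_Fq q n Z"
      by (simp add: cyclic_code_Fq_eq)
  next
    fix c
    assume "c \<in> cyclic_code_Fq q n Z"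
    then have c: "\<And>i. c i \<in> ?F" "\<And>i. i \<ge> n \<Longrightarrow> c i = 0"
      "\<And>x. x \<in> Z \<Longrightarrow> (\<Sum>i<n. c i * x ^ i) = 0"
      by (auto simp: cyclic_code_Fq_eq)
    obtain f where f: "word_poly n c = f * gen_poly Z"
      using word_eq_gen_poly_mult[OF n_pos, of Z c] c(2,3) by auto
    have fF: "coeff f i \<in> ?F" for i
    proof (rule cofactor_Fq)
      show "coeff (f * gen_poly Z) j \<in> ?F" for j
        using c(1) by (simp add: f[symmetric] coeff_word_poly zero_in_subfield_Fq[OF prime_power])
    qed
    have coeff_f: "coeff f i = 0" if "i \<ge> ?k" for i
    proof (cases "f = 0")
      case False
      then have "degree f + card Z < n"
        using degree_word_poly[OF n_pos, of c] f gen_poly_degree[of Z] by (simp add: degree_mult_eq)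
      then show ?thesis
        using that by (intro coeff_eq_0) linarith
    qed simp
    \<comment> \<open>Restriction makes the message extensional, as membership in the function space
      \<open>W\<close> demands.\<close>
    define w where "w = restrict (coeff f) {..<?k}"
    have "word_poly ?k w = f"
      using coeff_f by (simp add: poly_eq_iff coeff_word_poly w_def)
    then have "c = enc w"
      using c(2) by (simp add: enc_def fun_eq_iff f[symmetric] coeff_word_poly)
    moreover have "w \<in> W"
      using fF by (simp add: W_def w_def)
    ultimately show "c \<in> enc ` W"
      by blast
  qed
  ultimately have "card (cyclic_code_Fq q n Z) = card W"
    by (metis card_image)
  also have "\<dots> = q ^ ?k"
    by (simp add: W_def card_PiE card_subfield_Fq[OF prime_power card_field])
  finally show ?thesis .
qed

end

section \<open>Minimum distance and the Singleton-type bound\<close>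

lemma finite_distances: "finite {hamming_dist n x y | x y. x \<in> C \<and> y \<in> C \<and> x \<noteq> y}"
proof (rule finite_subset)
  have "hamming_dist n x y \<le> n" for x y :: "nat \<Rightarrow> 'a"
    using card_mono[of "{..<n}" "{i. i < n \<and> x i \<noteq> y i}"] by (auto simp: hamming_dist_def)
  then show "{hamming_dist n x y | x y. x \<in> C \<and> y \<in> C \<and> x \<noteq> y} \<subseteq> {..n}"
    by auto
qed simp

lemma min_dist_le:
  assumes "x \<in> C" and "y \<in> C" and "x \<noteq> y"
  shows "min_dist n C \<le> hamming_dist n x y"
  unfolding min_dist_def using assms by (intro Min_le finite_distances) auto

lemma min_dist_attained:
  assumes "x \<in> C" and "y \<in> C" and "x \<noteq> y"
  obtains v w where "v \<in> C" and "w \<in> C" and "v \<noteq> w" and "hamming_dist n v w = min_dist n C"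
proof -
  have "min_dist n C \<in> {hamming_dist n x y | x y. x \<in> C \<and> y \<in> C \<and> x \<noteq> y}"
    unfolding min_dist_def using assms by (intro Min_in finite_distances) auto
  then show ?thesis
    using that by auto
qed

lemma hamming_dist_le_card_diff:
  assumes "T \<subseteq> {..<n}" and "\<And>j. j \<in> T \<Longrightarrow> x j = y j"
  shows "hamming_dist n x y \<le> n - card T"
proof -
  have "hamming_dist n x y \<le> card ({..<n} - T)"
    unfolding hamming_dist_def by (intro card_mono) (use assms(2) in auto)
  also have "\<dots> = n - card T"
    using assms(1) by (simp add: card_Diff_subset finite_subset)
  finally show ?thesis .
qed

text \<open>Pigeonhole: restrictions to \<open>U\<close> take at most \<open>card F ^ card U\<close>
  values, fewer than there are words. Counting stands in for a dimension argument.\<close>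

lemma exists_agreeing_words:
  fixes C :: "(nat \<Rightarrow> 'a) set"
  assumes "finite F" and "card F > 1" and "\<forall>c\<in>C. \<forall>i. c i \<in> F" and "card C = card F ^ k"
    and "finite U" and "card U < k"
  shows "\<exists>x\<in>C. \<exists>y\<in>C. x \<noteq> y \<and> (\<forall>j\<in>U. x j = y j)"
proof -
  have "\<not> inj_on (\<lambda>x. restrict x U) C"
  proof
    assume "inj_on (\<lambda>x. restrict x U) C"
    then have "card C \<le> card (U \<rightarrow>\<^sub>E F)"
      using assms(1,3,5) by (intro card_inj_on_le[where f = "\<lambda>x. restrict x U"]) (auto intro: finite_PiE)
    also have "\<dots> = card F ^ card U"
      using assms(5) by (simp add: card_PiE)
    also have "\<dots> < card F ^ k"
      using assms(2,6) by (simp add: power_strict_increasing)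
    finally show False
      using assms(4) by simp
  qed
  then obtain x y where xy: "x \<in> C" "y \<in> C" "x \<noteq> y" "restrict x U = restrict y U"
    by (auto simp: inj_on_def)
  have "x j = y j" if "j \<in> U" for j
    using fun_cong[OF xy(4), of j] that by simp
  with xy show ?thesis
    by blast
qed

text \<open>Invariant of the counting argument for the Singleton-type bound. Adjoining a repair group
  \<open>S\<close> of an undetermined coordinate enlarges \<open>T\<close> by at least \<open>\<delta> - 1\<close> more coordinates than \<open>U\<close>,
  since any \<open>\<delta> - 1\<close> coordinates of \<open>S\<close> can be recovered from the rest.\<close>
definition determines :: "(nat \<Rightarrow> 'a) set \<Rightarrow> nat set \<Rightarrow> nat set \<Rightarrow> bool" where
  "determines C U T \<longleftrightarrow> (\<forall>x\<in>C. \<forall>y\<in>C. (\<forall>j\<in>U. x j = y j) \<longrightarrow> (\<forall>j\<in>T. x j = y j))"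

lemma determinesD:
  "determines C U T \<Longrightarrow> x \<in> C \<Longrightarrow> y \<in> C \<Longrightarrow> (\<And>j. j \<in> U \<Longrightarrow> x j = y j) \<Longrightarrow> j \<in> T \<Longrightarrow> x j = y j"
  unfolding determines_def by blast

text \<open>On \<open>S\<close> the two words can differ only inside \<open>V\<close>, that is in
  fewer than \<delta> places, so the local distance forces equality.\<close>

lemma locality_recovers:
  assumes dist: "\<forall>x\<in>C. \<forall>y\<in>C. puncture x S \<noteq> puncture y S \<longrightarrow>
             hamming_dist n (puncture x S) (puncture y S) \<ge> \<delta>"
    and "S \<subseteq> {..<n}" and "finite V" and "card V < \<delta>"
    and "x \<in> C" and "y \<in> C" and agree: "\<And>j. j \<in> S - V \<Longrightarrow> x j = y j" and "j \<in> S"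
  shows "x j = y j"
proof (rule ccontr)
  assume "x j \<noteq> y j"
  then have "puncture x S j \<noteq> puncture y S j"
    using assms(8) by (simp add: puncture_def)
  then have "puncture x S \<noteq> puncture y S"
    by auto
  then have "\<delta> \<le> hamming_dist n (puncture x S) (puncture y S)"
    using dist assms(5,6) by blast
  also have "\<dots> \<le> card V"
    unfolding hamming_dist_def
    using assms(3) agree by (intro card_mono) (auto simp: puncture_def split: if_splits)
  finally show False
    using assms(4) by simp
qed

text \<open>Grow a set \<open>U\<close> of \<open>k - 1\<close> coordinates that determines at least
  \<open>k - 1 + s * (\<delta> - 1)\<close> coordinates \<open>T\<close>: first by \<open>s\<close>
  repair groups, then one coordinate at a time. Two distinct words agreeing on \<open>U\<close>
  agree on \<open>T\<close>, which bounds their distance.\<close>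

lemma LRC_singleton_bound:
  fixes C :: "(nat \<Rightarrow> 'a::zero) set"
  assumes lrc: "is_LRC n C r \<delta>"
    and F: "finite F" "card F > 1" "\<forall>c\<in>C. \<forall>i. c i \<in> F"
    and supp: "\<And>c i. c \<in> C \<Longrightarrow> i \<ge> n \<Longrightarrow> c i = 0"
    and card: "card C = card F ^ k" and "k > 0"
  shows "int (min_dist n C) \<le> int n - int k - (\<lceil>real k / real_of_int r\<rceil> - 1) * (int \<delta> - 1) + 1"
proof -
  define R where "R = nat r"
  have R: "R \<ge> 1" "int R = r" and \<delta>: "\<delta> \<ge> 2"
    using lrc by (auto simp: is_LRC_def R_def)
  \<comment> \<open>The choice of \<open>s\<close> ensures \<open>s * R < k\<close>, so
    \<open>U\<close> stays too small to determine every word while groups are being added.\<close>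
  define s where "s = nat (\<lceil>real k / real R\<rceil> - 1)"
  have ceil: "\<lceil>real k / real R\<rceil> = int s + 1"
    using R(1) assms(7) by (simp add: s_def)
  then have "real s < real k / real R"
    by linarith
  then have "real (s * R) < real k"
    using R(1) by (simp add: field_simps)
  then have sR: "s * R < k"
    by linarith
  note words = exists_agreeing_words[OF F card]
  have undetermined: "\<exists>l<n. \<exists>x\<in>C. \<exists>y\<in>C. (\<forall>j\<in>U. x j = y j) \<and> x l \<noteq> y l"
    if "U \<subseteq> {..<n}" "card U < k" for U
  proof -
    have "finite U"
      using that(1) finite_subset by auto
    from words[OF this that(2)] obtain x y where xy: "x \<in> C" "y \<in> C" "x \<noteq> y" "\<And>j. j \<in> U \<Longrightarrow> x j = y j"
      by blast
    then obtain l where "x l \<noteq> y l"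
      by auto
    then have "l < n"
      using supp xy(1,2) by (metis not_le)
    with xy \<open>x l \<noteq> y l\<close> show ?thesis
      by blast
  qed
  have groups: "\<exists>U T. U \<subseteq> {..<n} \<and> T \<subseteq> {..<n} \<and> determines C U T \<and>
      card U + j * (\<delta> - 1) \<le> card T \<and> card U \<le> j * R" if "j \<le> s" for j
    using that
  proof (induction j)
    case 0
    show ?case
      by (intro exI[of _ "{}"]) (simp add: determines_def)
  next
    case (Suc j)
    then obtain U T where UT: "U \<subseteq> {..<n}" "T \<subseteq> {..<n}" "determines C U T"
      "card U + j * (\<delta> - 1) \<le> card T" "card U \<le> j * R"
      by auto
    have fin: "finite U" "finite T"
      using UT(1,2) finite_subset by auto
    have "j * R \<le> s * R"
      using Suc.prems by simp
    then have "card U < k"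
      using UT(5) sR by linarith
    then obtain l x y where lxy: "l < n" "x \<in> C" "y \<in> C" "\<And>j. j \<in> U \<Longrightarrow> x j = y j" "x l \<noteq> y l"
      using undetermined[OF UT(1)] by blast
    have "has_locality n C r \<delta> l"
      using lrc lxy(1) by (simp add: is_LRC_def)
    then obtain S where S: "S \<subseteq> {..<n}" "l \<in> S" "int (card S) \<le> r + int \<delta> - 1"
      "\<forall>x\<in>C. \<forall>y\<in>C. puncture x S \<noteq> puncture y S \<longrightarrow>
             hamming_dist n (puncture x S) (puncture y S) \<ge> \<delta>"
      unfolding has_locality_def by blast
    have finS: "finite S"
      using S(1) finite_subset by auto
    \<comment> \<open>Otherwise the coordinates in \<open>T\<close> would recover all of
      \<open>S\<close>, including \<open>l\<close>, where \<open>x\<close> and \<open>y\<close>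
      differ.\<close>
    have large: "\<delta> \<le> card (S - T)"
    proof (rule ccontr)
      assume "\<not> ?thesis"
      then have small: "card (S - T) < \<delta>"
        by simp
      have "x j = y j" if "j \<in> S - (S - T)" for j
        using determinesD[OF UT(3) lxy(2,3,4)] that by simp
      from locality_recovers[OF S(4,1) _ small lxy(2,3) this S(2)] have "x l = y l"
        using finS by simp
      then show False
        using lxy(5) by simp
    qed
    have "\<delta> - 1 \<le> card (S - T)"
      using large by simp
    then obtain V where V: "V \<subseteq> S - T" "card V = \<delta> - 1"
      by (meson obtain_subset_with_card_n)
    have finV: "finite V"
      using V(1) finS finite_subset by blast
    \<comment> \<open>All new coordinates of \<open>S\<close> except the \<delta> - 1 in
      \<open>V\<close> are charged to \<open>U'\<close>, at most \<open>R\<close> of them.\<close>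
    define U' where "U' = U \<union> (S - T - V)"
    define T' where "T' = T \<union> S"
    have det: "determines C U' T'"
      unfolding determines_def
    proof (intro ballI impI)
      fix x y j
      assume xy: "x \<in> C" "y \<in> C" "\<forall>j\<in>U'. x j = y j" and j: "j \<in> T'"
      have onT: "x j = y j" if "j \<in> T" for j
        using determinesD[OF UT(3) xy(1,2), of j] xy(3) that by (simp add: U'_def)
      have onS: "x j = y j" if "j \<in> S - V" for j
        using that onT xy(3) by (auto simp: U'_def)
      have "card V < \<delta>"
        using V(2) \<delta> by simp
      from locality_recovers[OF S(4,1) finV this xy(1,2) onS] have "x j = y j" if "j \<in> S"
        using that by blast
      then show "x j = y j"
        using j onT by (auto simp: T'_def)
    qed
    have cV: "card (S - T - V) = card (S - T) - (\<delta> - 1)"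
      using V finV by (simp add: card_Diff_subset)
    have "card U' \<le> card U + card (S - T - V)"
      unfolding U'_def by (rule card_Un_le)
    moreover have "card T' = card T + card (S - T)"
      unfolding T'_def using fin finS by (metis Diff_disjoint Un_Diff_cancel card_Un_disjoint finite_Diff)
    moreover have "card (S - T) \<le> card S"
      using finS by (simp add: card_mono)
    moreover have "card S \<le> R + (\<delta> - 1)"
      using S(3) R(2) \<delta> by linarith
    ultimately have "card U' + Suc j * (\<delta> - 1) \<le> card T'" "card U' \<le> Suc j * R"
      using UT(4,5) cV large \<delta> unfolding mult_Suc by linarith+
    moreover have "U' \<subseteq> {..<n}" "T' \<subseteq> {..<n}"
      using UT(1,2) S(1) by (auto simp: U'_def T'_def)
    ultimately show ?case
      using det by blast
  qed
  obtain U\<^sub>0 T\<^sub>0 where UT0: "U\<^sub>0 \<subseteq> {..<n}" "T\<^sub>0 \<subseteq> {..<n}" "determines C U\<^sub>0 T\<^sub>0"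
    "card U\<^sub>0 + s * (\<delta> - 1) \<le> card T\<^sub>0" "card U\<^sub>0 \<le> s * R"
    using groups[of s] by blast
  have singles: "\<exists>U T. U \<subseteq> {..<n} \<and> T \<subseteq> {..<n} \<and> determines C U T \<and>
      card U + s * (\<delta> - 1) \<le> card T \<and> card U = card U\<^sub>0 + j" if "card U\<^sub>0 + j < k" for j
    using that
  proof (induction j)
    case 0
    show ?case
      using UT0 by auto
  next
    case (Suc j)
    then obtain U T where UT: "U \<subseteq> {..<n}" "T \<subseteq> {..<n}" "determines C U T"
      "card U + s * (\<delta> - 1) \<le> card T" "card U = card U\<^sub>0 + j"
      by auto
    have fin: "finite U" "finite T"
      using UT(1,2) finite_subset by auto
    have "card U < k"
      using UT(5) Suc.prems by simp
    then obtain l x y where lxy: "l < n" "x \<in> C" "y \<in> C" "\<And>j. j \<in> U \<Longrightarrow> x j = y j" "x l \<noteq> y l"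
      using undetermined[OF UT(1)] by blast
    \<comment> \<open>An undetermined coordinate is new to both sets, so the surplus of
      \<open>T\<close> over \<open>U\<close> is preserved.\<close>
    have "l \<notin> U" "l \<notin> T"
      using lxy determinesD[OF UT(3) lxy(2-4)] by auto
    then have "card (insert l U) + s * (\<delta> - 1) \<le> card (insert l T)"
      "card (insert l U) = card U\<^sub>0 + Suc j"
      using UT(4,5) fin by auto
    moreover have "determines C (insert l U) (insert l T)"
      using UT(3) unfolding determines_def by blast
    ultimately show ?case
      using UT(1,2) lxy(1) by (meson insert_subset lessThan_iff)
  qed
  have "card U\<^sub>0 + (k - 1 - card U\<^sub>0) = k - 1"
    using UT0(5) sR by linarith
  then obtain U T where UT: "U \<subseteq> {..<n}" "T \<subseteq> {..<n}" "determines C U T"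
      "card U + s * (\<delta> - 1) \<le> card T" "card U = k - 1"
    using singles[of "k - 1 - card U\<^sub>0"] \<open>k > 0\<close> by auto
  have "finite U" "card U < k"
    using UT(1,5) \<open>k > 0\<close> finite_subset by auto
  from words[OF this] obtain x y
    where xy: "x \<in> C" "y \<in> C" "x \<noteq> y" "\<And>j. j \<in> U \<Longrightarrow> x j = y j"
    by blast
  have "x j = y j" if "j \<in> T" for j
    using determinesD[OF UT(3) xy(1,2,4) that] by simp
  then have "hamming_dist n x y \<le> n - card T"
    by (rule hamming_dist_le_card_diff[OF UT(2)])
  then have "min_dist n C \<le> n - card T"
    using min_dist_le[OF xy(1-3), of n] by linarith
  moreover have "card T \<le> n"
    using card_mono[OF _ UT(2)] by simp
  ultimately have "int (min_dist n C) \<le> int n - int (card T)"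
    by linarith
  also have "\<dots> \<le> int n - (int k - 1 + int s * (int \<delta> - 1))"
  proof -
    have "int (card U + s * (\<delta> - 1)) \<le> int (card T)"
      using UT(4) by (simp only: of_nat_le_iff)
    then show ?thesis
      using UT(5) \<open>k > 0\<close> \<delta> by (simp add: of_nat_diff)
  qed
  also have "\<dots> = int n - int k - (\<lceil>real k / real_of_int r\<rceil> - 1) * (int \<delta> - 1) + 1"
    using ceil R(2) by (simp flip: R(2))
  finally show ?thesis .
qed

section \<open>Locality from the dual code\<close>

definition cyclic_shift :: "nat \<Rightarrow> nat \<Rightarrow> (nat \<Rightarrow> 'a::zero) \<Rightarrow> nat \<Rightarrow> 'a" where
  "cyclic_shift n h v = (\<lambda>i. if i < n then v ((i + h) mod n) else 0)"

lemma shift_inverse: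
  fixes n h :: nat
  obtains h' where "\<And>i. i < n \<Longrightarrow> ((i + h) mod n + h') mod n = i"
    and "\<And>i. i < n \<Longrightarrow> ((i + h') mod n + h) mod n = i"
proof
  fix i
  assume i: "i < n"
  \<comment> \<open>The inverse shift is \<open>n - h mod n\<close>; reducing \<open>h\<close> first
    keeps the subtraction exact for \<open>h > n\<close>.\<close>
  have "(i + (h + (n - h mod n))) mod n = (i + (h mod n + (n - h mod n))) mod n"
    by (metis mod_add_left_eq mod_add_right_eq)
  also have "\<dots> = i"
    using i by simp
  finally have *: "(i + (h + (n - h mod n))) mod n = i" .
  then show "((i + h) mod n + (n - h mod n)) mod n = i"
    by (metis add.assoc mod_add_left_eq)
  show "((i + (n - h mod n)) mod n + h) mod n = i"
    using * by (metis add.assoc add.commute mod_add_left_eq)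
qed

lemma bij_betw_shift:
  assumes "n > 0"
  shows "bij_betw (\<lambda>i. (i + h) mod n) {..<n :: nat} {..<n}"
proof -
  obtain h' where "\<And>i. i < n \<Longrightarrow> ((i + h) mod n + h') mod n = i"
    and "\<And>i. i < n \<Longrightarrow> ((i + h') mod n + h) mod n = i"
    by (rule shift_inverse[of n h]) blast
  then show ?thesis
    using assms by (intro bij_betw_byWitness[where f' = "\<lambda>i. (i + h') mod n"]) auto
qed

text \<open>Up to the unit \<open>x ^ h\<close>, shifting does not change the evaluation at an
  \<open>n\<close>-th root of unity \<open>x\<close>.\<close>

lemma cyclic_code_big_shift:
  fixes A :: "'a::field set"
  assumes "n > 0" and "finite A" and "\<And>x. x \<in> A \<Longrightarrow> x ^ n = 1" and "c \<in> cyclic_code_big n A"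
  shows "cyclic_shift n h c \<in> cyclic_code_big n A"
proof -
  have "(\<Sum>i<n. cyclic_shift n h c i * x ^ i) = 0" if "x \<in> A" for x
  proof -
    have xn: "x ^ n = 1"
      using assms(3) that .
    then have "x \<noteq> 0"
      using assms(1) by (auto simp: power_0_left)
    have "x ^ h * (\<Sum>i<n. cyclic_shift n h c i * x ^ i) = (\<Sum>i<n. c ((i + h) mod n) * x ^ ((i + h) mod n))"
      by (simp add: sum_distrib_left cyclic_shift_def power_mod_order[OF xn] power_add mult_ac)
    also have "\<dots> = (\<Sum>j<n. c j * x ^ j)"
      by (rule sum.reindex_bij_betw[OF bij_betw_shift[OF assms(1)]])
    also have "\<dots> = 0"
      using assms that by (simp add: cyclic_code_big_eq)
    finally show ?thesis
      using \<open>x \<noteq> 0\<close> by simp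
  qed
  then show ?thesis
    using assms(1-3) by (simp add: cyclic_code_big_eq) (simp add: cyclic_shift_def)
qed

text \<open>The adjoint of a shift is the inverse shift, under which the code is closed.\<close>

lemma dual_code_shift:
  assumes "n > 0" and "\<And>c h. c \<in> C \<Longrightarrow> cyclic_shift n h c \<in> C" and "v \<in> dual_code n C"
  shows "cyclic_shift n h v \<in> dual_code n C"
proof -
  have "(\<Sum>i<n. cyclic_shift n h v i * c i) = 0" if "c \<in> C" for c
  proof -
    obtain h' where h': "\<And>i. i < n \<Longrightarrow> ((i + h) mod n + h') mod n = i"
      by (rule shift_inverse[of n h]) blast
    let ?c = "cyclic_shift n h' c"
    have "(\<Sum>i<n. cyclic_shift n h v i * c i) = (\<Sum>i<n. v ((i + h) mod n) * ?c ((i + h) mod n))"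
      by (intro sum.cong) (auto simp: cyclic_shift_def h')
    also have "\<dots> = (\<Sum>j<n. v j * ?c j)"
      by (rule sum.reindex_bij_betw[OF bij_betw_shift[OF assms(1)]])
    also have "\<dots> = 0"
      using assms(2,3) that by (simp add: dual_code_def)
    finally show ?thesis .
  qed
  then show ?thesis
    by (simp add: dual_code_def) (simp add: cyclic_shift_def)
qed

lemma dual_code_diff:
  assumes "v \<in> dual_code n C" and "w \<in> dual_code n C"
  shows "(\<lambda>i. v i - w i) \<in> dual_code n C"
  using assms by (simp add: dual_code_def left_diff_distrib sum_subtractf)

lemma dual_code_min_word_at:
  fixes A :: "'a::field set"
  assumes "n > 0" and "finite A" and "A \<noteq> {}" and "\<And>x. x \<in> A \<Longrightarrow> x ^ n = 1" and "l < n"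
  obtains u where "u \<in> dual_code n (cyclic_code_big n A)" and "u l \<noteq> 0"
    and "card {i. i < n \<and> u i \<noteq> 0} = min_dist n (dual_code n (cyclic_code_big n A))"
proof -
  let ?C = "cyclic_code_big n A" and ?D = "dual_code n (cyclic_code_big n A)"
  obtain a where a: "a \<in> A"
    using assms(3) by auto
  \<comment> \<open>The powers of a root \<open>a\<close> form a parity check, nonzero at position
    0; so the dual has two distinct words and its minimum distance is attained.\<close>
  have "(\<lambda>i. if i < n then a ^ i else 0) \<in> ?D"
    using assms(1,2,4) a by (simp add: dual_code_def cyclic_code_big_eq mult.commute)
  moreover have "(\<lambda>i. 0) \<in> ?D"
    by (simp add: dual_code_def)
  moreover have "(\<lambda>i. if i < n then a ^ i else 0) \<noteq> (\<lambda>i. 0)"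
    using assms(1) by (auto simp: fun_eq_iff intro!: exI[of _ 0])
  ultimately obtain v w where vw: "v \<in> ?D" "w \<in> ?D" "v \<noteq> w" "hamming_dist n v w = min_dist n ?D"
    by (rule min_dist_attained)
  define u where "u = (\<lambda>i. v i - w i)"
  have u: "u \<in> ?D"
    unfolding u_def using vw(1,2) by (rule dual_code_diff)
  have weight: "card {i. i < n \<and> u i \<noteq> 0} = min_dist n ?D"
    using vw(4) by (simp add: u_def hamming_dist_def)
  obtain j where "v j \<noteq> w j"
    using vw(3) by auto
  then have j: "j < n" "u j \<noteq> 0"
    using vw(1,2) by (auto simp: u_def dual_code_def) (metis not_le)
  \<comment> \<open>Position \<open>l\<close> of the shifted word reads position \<open>j\<close> of
    \<open>u\<close>; the summand \<open>n\<close> prevents truncation when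
    \<open>l > j\<close>.\<close>
  define u' where "u' = cyclic_shift n (j + n - l) u"
  have "u' \<in> ?D"
    unfolding u'_def using assms(1,2,4) u by (intro dual_code_shift cyclic_code_big_shift)
  moreover have "u' l \<noteq> 0"
    using j assms(5) by (simp add: u'_def cyclic_shift_def)
  moreover have "card {i. i < n \<and> u' i \<noteq> 0} = card {i. i < n \<and> u i \<noteq> 0}"
  proof -
    let ?f = "\<lambda>i. (i + (j + n - l)) mod n"
    have bij: "bij_betw ?f {..<n} {..<n}"
      by (rule bij_betw_shift[OF assms(1)])
    have "bij_betw ?f {i. i < n \<and> u' i \<noteq> 0} {i. i < n \<and> u i \<noteq> 0}"
    proof (rule bij_betw_subset[OF bij])
      show "?f ` {i. i < n \<and> u' i \<noteq> 0} = {i. i < n \<and> u i \<noteq> 0}"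
      proof (intro equalityI subsetI)
        fix e
        assume e: "e \<in> {i. i < n \<and> u i \<noteq> 0}"
        then obtain i where "i < n" "e = ?f i"
          using bij by (auto simp: bij_betw_def image_iff set_eq_iff)
        with e show "e \<in> ?f ` {i. i < n \<and> u' i \<noteq> 0}"
          by (auto simp: u'_def cyclic_shift_def)
      qed (use assms(1) in \<open>auto simp: u'_def cyclic_shift_def\<close>)
    qed auto
    then show ?thesis
      by (rule bij_betw_same_card)
  qed
  ultimately show ?thesis
    using that weight by simp
qed

text \<open>For \<open>b \<in> B\<close> the twisted word \<open>\<lambda>i. x i * b ^ i\<close> has the roots \<open>A\<close>, so it is orthogonal to the
  dual word \<open>u\<close>; hence the pointwise product of \<open>u\<close> and \<open>x\<close> has the consecutive roots \<open>B\<close>, and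
  the BCH bound applies to it.\<close>
lemma locality_from_dual:
  fixes A B :: "'a::field set" and C :: "(nat \<Rightarrow> 'a) set"
  assumes "n > 0" and "finite A" and "A \<noteq> {}" and "\<And>x. x \<in> A \<Longrightarrow> x ^ n = 1"
    and g: "primitive_root_of_unity n g" and "c \<noteq> 0" and B: "\<And>j. j < \<delta> - 1 \<Longrightarrow> c * g ^ j \<in> B"
    and C: "\<And>x b. x \<in> C \<Longrightarrow> b \<in> setprod A B \<Longrightarrow> (\<Sum>i<n. x i * b ^ i) = 0"
    and "l < n"
  shows "has_locality n C (int (min_dist n (dual_code n (cyclic_code_big n A))) - int \<delta> + 1) \<delta> l"
proof -
  obtain u where u: "u \<in> dual_code n (cyclic_code_big n A)" "u l \<noteq> 0"
    "card {i. i < n \<and> u i \<noteq> 0} = min_dist n (dual_code n (cyclic_code_big n A))"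
    by (rule dual_code_min_word_at[OF assms(1-4,9)])
  define S where "S = {i. i < n \<and> u i \<noteq> 0}"
  have roots: "(\<Sum>i<n. u i * x i * b ^ i) = 0" if x: "x \<in> C" and b: "b \<in> B" for x b
  proof -
    define y where "y = (\<lambda>i. if i < n then x i * b ^ i else 0)"
    have "(\<Sum>i<n. y i * a ^ i) = 0" if "a \<in> A" for a
    proof -
      have "a * b \<in> setprod A B"
        using that b by (auto simp: setprod_def)
      from C[OF x this] show ?thesis
        by (simp add: y_def power_mult_distrib mult_ac)
    qed
    then have "y \<in> cyclic_code_big n A"
      using assms(1,2,4) by (simp add: cyclic_code_big_eq) (simp add: y_def)
    then have "(\<Sum>i<n. u i * y i) = 0"
      using u(1) by (simp add: dual_code_def)
    then show ?thesis
      by (simp add: y_def mult_ac)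
  qed
  have "\<delta> \<le> hamming_dist n (puncture x S) (puncture y S)"
    if x: "x \<in> C" and y: "y \<in> C" and neq: "puncture x S \<noteq> puncture y S" for x y
  proof -
    \<comment> \<open>Inside \<open>S\<close> the factor \<open>u i\<close> is nonzero and outside
      it is zero, so the weight of \<open>z\<close> is exactly the distance of the punctured
      words.\<close>
    define z where "z = (\<lambda>i. u i * (x i - y i))"
    obtain e where e: "puncture x S e \<noteq> puncture y S e"
      using neq by auto
    then have "e < n" "z e \<noteq> 0"
      by (auto simp: puncture_def S_def z_def split: if_splits)
    moreover have "(\<Sum>i<n. z i * (c * g ^ j) ^ i) = 0" if "j < \<delta> - 1" for j
      using roots[OF x B[OF that]] roots[OF y B[OF that]]
      by (simp add: z_def algebra_simps sum_subtractf)
    ultimately have "\<delta> - 1 + 1 \<le> card {i. i < n \<and> z i \<noteq> 0}"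
      by (intro BCH_bound[OF g assms(1,6)])
    also have "{i. i < n \<and> z i \<noteq> 0} = {i. i < n \<and> puncture x S i \<noteq> puncture y S i}"
      by (auto simp: z_def puncture_def S_def)
    finally show ?thesis
      by (simp add: hamming_dist_def)
  qed
  moreover have "int (card S) \<le> int (min_dist n (dual_code n (cyclic_code_big n A))) - int \<delta> + 1 + int \<delta> - 1"
    using u(3) by (simp add: S_def)
  ultimately show ?thesis
    unfolding has_locality_def using u(2) assms(9) by (intro exI[of _ S]) (auto simp: S_def)
qed

section \<open>The defining set\<close>

text \<open>The parameter \<open>d\<close> stands for the size \<delta> - 1 of \<open>B\<close>;
  adding \<open>d\<close> consecutive exponents to a run of length \<open>m\<close> gives one of
  length \<open>m + d - 1\<close>.\<close>

definition exponents :: "nat \<Rightarrow> (nat \<Rightarrow> nat) \<Rightarrow> nat \<Rightarrow> nat \<Rightarrow> nat set" where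
  "exponents m i s d = {..<m + d - 1} \<union> (\<Union>l\<in>{1..s}. {i l..<i l + d})"

lemma setA_eq: "setA \<alpha> t b m i s = (\<lambda>e. \<alpha> ^ t * (\<alpha> ^ b) ^ e) ` ({..<m} \<union> i ` {1..s})"
  unfolding setA_def by (auto simp: power_add power_mult mult.commute[of _ b])

text \<open>For \<delta> = 2 * h + 3 the indices run from \<open>- h\<close> to
  \<open>h + 1\<close>; shifting by \<open>h\<close> turns them into natural numbers, at the price
  of a constant factor.\<close>

lemma setB_eq:
  assumes "\<alpha> \<noteq> 0" and "\<delta> = 2 * h + 3"
  shows "setB \<alpha> b \<delta> = (\<lambda>j. inverse (\<alpha> ^ b) ^ h * (\<alpha> ^ b) ^ j) ` {..<\<delta> - 1}"
proof -
  have bounds: "(int \<delta> - 3) div 2 = int h" "(int \<delta> - 1) div 2 = int h + 1"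
    using assms(2) by auto
  have g: "\<alpha> powi ((int j - int h) * int b) = inverse (\<alpha> ^ b) ^ h * (\<alpha> ^ b) ^ j" for j
  proof -
    have "\<alpha> powi ((int j - int h) * int b) = (\<alpha> ^ b) powi (int j - int h)"
      by (simp add: mult.commute[of _ "int b"] power_int_mult)
    also have "\<dots> = inverse (\<alpha> ^ b) ^ h * (\<alpha> ^ b) ^ j"
      using assms(1) by (simp add: power_int_diff field_simps)
    finally show ?thesis .
  qed
  show ?thesis
  proof (intro equalityI subsetI)
    fix x
    assume "x \<in> setB \<alpha> b \<delta>"
    then obtain j where j: "x = \<alpha> powi (j * int b)" "- int h \<le> j" "j \<le> int h + 1"
      by (auto simp: setB_def bounds)
    then have "int (nat (j + int h)) - int h = j" "nat (j + int h) < \<delta> - 1"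
      using assms(2) by auto
    with g[of "nat (j + int h)"] j(1) show "x \<in> (\<lambda>j. inverse (\<alpha> ^ b) ^ h * (\<alpha> ^ b) ^ j) ` {..<\<delta> - 1}"
      by auto
  next
    fix x
    assume "x \<in> (\<lambda>j. inverse (\<alpha> ^ b) ^ h * (\<alpha> ^ b) ^ j) ` {..<\<delta> - 1}"
    then obtain j where j: "j < \<delta> - 1" "x = \<alpha> powi ((int j - int h) * int b)"
      using g by auto
    then show "x \<in> setB \<alpha> b \<delta>"
      unfolding setB_def bounds using assms(2) by (auto intro!: exI[of _ "int j - int h"])
  qed
qed

lemma setprod_eq:
  assumes "\<alpha> \<noteq> 0" and "\<delta> = 2 * h + 3" and "m > 0"
  shows "setprod (setA \<alpha> t b m i s) (setB \<alpha> b \<delta>) =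
    (\<lambda>e. \<alpha> ^ t * inverse (\<alpha> ^ b) ^ h * (\<alpha> ^ b) ^ e) ` exponents m i s (\<delta> - 1)"
proof -
  let ?E = "{..<m} \<union> i ` {1..s}" and ?c = "\<alpha> ^ t * inverse (\<alpha> ^ b) ^ h"
  have "setprod (setA \<alpha> t b m i s) (setB \<alpha> b \<delta>) =
      {\<alpha> ^ t * (\<alpha> ^ b) ^ e * (inverse (\<alpha> ^ b) ^ h * (\<alpha> ^ b) ^ j) | e j. e \<in> ?E \<and> j < \<delta> - 1}"
    unfolding setprod_def setA_eq setB_eq[OF assms(1,2)] by blast
  also have "\<dots> = {?c * (\<alpha> ^ b) ^ (e + j) | e j. e \<in> ?E \<and> j < \<delta> - 1}"
    by (simp only: power_add mult_ac)
  also have "\<dots> = (\<lambda>e. ?c * (\<alpha> ^ b) ^ e) ` {e + j | e j. e \<in> ?E \<and> j < \<delta> - 1}"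
    by blast
  also have "{e + j | e j. e \<in> ?E \<and> j < \<delta> - 1} = exponents m i s (\<delta> - 1)"
  proof (intro equalityI subsetI)
    fix x
    assume "x \<in> {e + j | e j. e \<in> ?E \<and> j < \<delta> - 1}"
    then show "x \<in> exponents m i s (\<delta> - 1)"
      using assms(3) by (force simp: exponents_def)
  next
    fix x
    assume "x \<in> exponents m i s (\<delta> - 1)"
    then consider "x < m + (\<delta> - 1) - 1" | l where "l \<in> {1..s}" "i l \<le> x" "x < i l + (\<delta> - 1)"
      by (auto simp: exponents_def)
    then show "x \<in> {e + j | e j. e \<in> ?E \<and> j < \<delta> - 1}"
    proof cases
      case 1
      \<comment> \<open>Take as much as possible from the run of \<open>A\<close> and leave the
        excess over \<open>m - 1\<close> to \<open>B\<close>.\<close>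
      then have "x = min x (m - 1) + (x - min x (m - 1))" "min x (m - 1) \<in> ?E"
        "x - min x (m - 1) < \<delta> - 1"
        using assms(2,3) by auto
      then show ?thesis
        by blast
    next
      case 2
      then have "x = i l + (x - i l)" "i l \<in> ?E" "x - i l < \<delta> - 1"
        by auto
      then show ?thesis
        by blast
    qed
  qed
  finally show ?thesis .
qed

lemma spaced_sequence:
  fixes i :: "nat \<Rightarrow> nat"
  assumes "\<forall>l. 1 \<le> l \<and> l < s \<longrightarrow> i (l + 1) \<ge> i l + \<delta>" and "1 \<le> l" and "l + d \<le> s"
  shows "i l + d * \<delta> \<le> i (l + d)"
  using assms(3)
proof (induction d)
  case (Suc d)
  moreover have "i (l + d) + \<delta> \<le> i (l + d + 1)"
    using assms(1,2) Suc.prems by auto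
  ultimately show ?case
    by simp
qed simp

text \<open>Starting points lie \<delta> apart while the short runs have length \<delta> - 1, so all
  runs are disjoint. The bound \<open>n - 1\<close> rather than \<open>n\<close> later yields a
  positive dimension.\<close>

lemma exponents_card:
  assumes "m - 1 + \<delta> \<le> i 1" and "i s + \<delta> \<le> n" and "\<delta> \<ge> 2" and "s > 0" and "m > 0"
    and gaps: "\<forall>l. 1 \<le> l \<and> l < s \<longrightarrow> i (l + 1) \<ge> i l + \<delta>"
  shows "exponents m i s (\<delta> - 1) \<subseteq> {..<n - 1}"
    and "card (exponents m i s (\<delta> - 1)) = m - 1 + (s + 1) * (\<delta> - 1)"
proof -
  have spaced: "i l + \<delta> \<le> i l'" if "1 \<le> l" "l < l'" "l' \<le> s" for l l'
  proof -
    have "i l + (l' - l) * \<delta> \<le> i l'"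
      using spaced_sequence[OF gaps, of l "l' - l"] that by simp
    moreover have "1 * \<delta> \<le> (l' - l) * \<delta>"
      using that by (intro mult_right_mono) auto
    ultimately show ?thesis
      by linarith
  qed
  have first: "m - 1 + \<delta> \<le> i l" if "1 \<le> l" "l \<le> s" for l
    using spaced[of 1 l] that assms(1) by (cases "l = 1") auto
  have last: "i l + \<delta> \<le> n" if "1 \<le> l" "l \<le> s" for l
    using spaced[of l s] that assms(2) by (cases "l = s") auto
  show "exponents m i s (\<delta> - 1) \<subseteq> {..<n - 1}"
  proof
    fix x
    assume "x \<in> exponents m i s (\<delta> - 1)"
    then consider "x < m + (\<delta> - 1) - 1" | l where "1 \<le> l" "l \<le> s" "x < i l + (\<delta> - 1)"
      by (auto simp: exponents_def)
    then show "x \<in> {..<n - 1}"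
    proof cases
      case 1
      then show ?thesis
        using first[of 1] last[of 1] assms(3,4) by simp
    next
      case 2
      then show ?thesis
        using last[of l] assms(3) by simp
    qed
  qed
  have disj: "{i l..<i l + (\<delta> - 1)} \<inter> {i l'..<i l' + (\<delta> - 1)} = {}"
    if "l \<in> {1..s}" "l' \<in> {1..s}" "l \<noteq> l'" for l l'
    using spaced[of l l'] spaced[of l' l] that by (cases "l < l'") auto
  have "card (\<Union>l\<in>{1..s}. {i l..<i l + (\<delta> - 1)}) = (\<Sum>l\<in>{1..s}. card {i l..<i l + (\<delta> - 1)})"
    using disj by (intro card_UN_disjoint) auto
  then have "card (\<Union>l\<in>{1..s}. {i l..<i l + (\<delta> - 1)}) = s * (\<delta> - 1)"
    by simp
  moreover have "{..<m + (\<delta> - 1) - 1} \<inter> (\<Union>l\<in>{1..s}. {i l..<i l + (\<delta> - 1)}) = {}"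
    using first assms(3) by fastforce
  ultimately show "card (exponents m i s (\<delta> - 1)) = m - 1 + (s + 1) * (\<delta> - 1)"
    unfolding exponents_def using assms(5) by (subst card_Un_disjoint) auto
qed

text \<open>The \<open>n\<close> distinct powers already exhaust the at most \<open>n\<close> roots.
  This converts the coset condition on exponents into closure of the defining set under
  \<open>x ^ q\<close>.\<close>

lemma root_of_unity_eq_power:
  assumes "primitive_root_of_unity n (\<alpha> :: 'a::field)" and "n > 0" and "x ^ n = 1"
  obtains j where "j < n" and "x = \<alpha> ^ j"
proof -
  have "(\<lambda>e. \<alpha> ^ e) ` {..<n} \<subseteq> {x. x ^ n = 1}"
    using assms(1) by (auto simp: primitive_root_of_unity_def) (metis mult.commute power_mult power_one)
  moreover have "card ((\<lambda>e. \<alpha> ^ e) ` {..<n}) = n"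
    using primitive_root_inj_on[OF assms(1,2)] by (simp add: card_image)
  ultimately have "(\<lambda>e. \<alpha> ^ e) ` {..<n} = {x. x ^ n = 1}"
    using card_roots_power_eq_1_le[OF assms(2), where ?'a = 'a] by (intro card_seteq) auto
  then show ?thesis
    using that assms(3) by auto
qed

section \<open>Parameters, locality and optimality of the code\<close>

theorem theorem5p4:
  fixes q n b s m t \<delta> :: nat
    and i :: "nat \<Rightarrow> nat"
    and \<alpha> :: "'a::{finite, field}"
  assumes "prime_power q"
    and "card (UNIV :: 'a set) = q ^ 2"
    and "n dvd q + 1"
    and "primitive_root_of_unity n \<alpha>"
    and "odd \<delta>" and "\<delta> \<ge> 3"
    and "b > 0" and "s > 0" and "m > 0"
    and "gcd b n = 1"
    and "t < n"
    and "m - 1 + \<delta> \<le> i 1"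
    and "i s + \<delta> \<le> n"
    and "\<forall>l. 1 \<le> l \<and> l < s \<longrightarrow> i (l + 1) \<ge> i l + \<delta>"
  defines "k \<equiv> n + 1 - m - (s + 1) * (\<delta> - 1)"
    and "r \<equiv> int (min_dist n (dual_code n (cyclic_code_big n (setA \<alpha> t b m i s)))) - int \<delta> + 1"
  assumes "union_of_cyclotomic_cosets q n \<alpha> (setprod (setA \<alpha> t b m i s) (setB \<alpha> b \<delta>))"
  shows "is_LRC n (cyclic_code_Fq q n (setprod (setA \<alpha> t b m i s) (setB \<alpha> b \<delta>))) r \<delta>
       \<and> card (cyclic_code_Fq q n (setprod (setA \<alpha> t b m i s) (setB \<alpha> b \<delta>))) = q ^ k
       \<and> (\<lceil>real k / real_of_int r\<rceil> = int s + 1 \<longrightarrow>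
            optimal_LRC n k (cyclic_code_Fq q n (setprod (setA \<alpha> t b m i s) (setB \<alpha> b \<delta>))) r \<delta>
            \<and> min_dist n (cyclic_code_Fq q n (setprod (setA \<alpha> t b m i s) (setB \<alpha> b \<delta>))) = m + \<delta> - 1)"
proof -
  define A where "A = setA \<alpha> t b m i s"
  define B where "B = setB \<alpha> b \<delta>"
  define Z where "Z = setprod A B"
  define C where "C = cyclic_code_Fq q n Z"
  define E where "E = exponents m i s (\<delta> - 1)"
  define g where "g = \<alpha> ^ b"
  define h where "h = (\<delta> - 3) div 2"
  have h: "\<delta> = 2 * h + 3"
    using assms(5,6) by (auto simp: h_def elim!: oddE)
  define c where "c = \<alpha> ^ t * inverse g ^ h"
  have n: "n > 0"
    using assms(11) by simp
  have \<alpha>0: "\<alpha> \<noteq> 0" and \<alpha>n: "\<alpha> ^ n = 1"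
    using primitive_root_nonzero[OF assms(4) n] assms(4) by (auto simp: primitive_root_of_unity_def)
  have g: "primitive_root_of_unity n g"
    unfolding g_def using assms(4) n assms(10) by (rule primitive_root_power_coprime)
  have g0: "g \<noteq> 0" and c0: "c \<noteq> 0"
    using \<alpha>0 by (auto simp: g_def c_def)
  have powers: "(\<alpha> ^ e) ^ n = 1" "(g ^ e) ^ n = 1" for e
    using \<alpha>n g by (metis mult.commute power_mult power_one primitive_root_of_unity_def)+
  have A_roots: "x ^ n = 1" if "x \<in> A" for x
    using that powers by (auto simp: A_def setA_eq power_mult_distrib simp flip: g_def)
  have A_fin: "finite A" "A \<noteq> {}"
    using assms(9) by (auto simp: A_def setA_eq)
  have Z: "Z = (\<lambda>e. c * g ^ e) ` E"
    using setprod_eq[OF \<alpha>0 h assms(9), of t b i s]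
    by (simp add: Z_def A_def B_def c_def g_def E_def)
  have E: "E \<subseteq> {..<n - 1}" "card E = m - 1 + (s + 1) * (\<delta> - 1)"
    unfolding E_def using exponents_card[OF assms(12,13) _ assms(8,9,14)] assms(6) by auto
  have "inj_on (\<lambda>e. c * g ^ e) E"
    using primitive_root_inj_on[OF g n] E(1) c0 by (fastforce simp: inj_on_def)
  then have card_Z: "card Z = card E"
    unfolding Z by (rule card_image)
  have "card E \<le> n - 1"
    using card_mono[OF _ E(1)] by simp
  \<comment> \<open>As \<open>card E\<close> is at most \<open>n - 1\<close>, the truncated
    subtractions in \<open>k\<close> are exact and \<open>k\<close> is positive.\<close>
  then have k: "n - card Z = k" "k > 0" "card Z \<le> n"
    using E(2) assms(9) n unfolding card_Z k_def by linarith+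
  have Z_roots: "x ^ n = 1" if "x \<in> Z" for x
    using that powers by (auto simp: Z c_def power_mult_distrib power_inverse)
  interpret Fq_cyclic_code q n Z
  proof
    fix x
    assume x: "x \<in> Z"
    then obtain j where j: "j < n" "x = \<alpha> ^ j"
      using root_of_unity_eq_power[OF assms(4) n] Z_roots by metis
    then have "\<alpha> ^ ((q * j) mod n) \<in> Z"
      using assms(17) x by (simp add: union_of_cyclotomic_cosets_def Z_def A_def B_def)
    then show "x ^ q \<in> Z"
      using j(2) by (simp add: power_mod_order[OF \<alpha>n] mult.commute power_mult)
  qed (use assms(1,2) n Z_roots in auto)
  have C: "C = {c. (\<forall>i. c i \<in> subfield_Fq q) \<and> (\<forall>i\<ge>n. c i = 0) \<and> (\<forall>x\<in>Z. (\<Sum>i<n. c i * x ^ i) = 0)}"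
    unfolding C_def by (rule cyclic_code_Fq_eq)
  have card_C: "card C = q ^ k"
    unfolding C_def using card_cyclic_code_Fq[OF k(3)] k(1) by simp
  have q1: "q > 1"
    using assms(1) by (rule prime_power_gt_1)
  have locality: "has_locality n C r \<delta> l" if "l < n" for l
    unfolding r_def A_def[symmetric]
  proof (rule locality_from_dual[OF n A_fin A_roots g _ _ _ that])
    show "inverse g ^ h \<noteq> 0"
      using g0 by simp
    show "inverse g ^ h * g ^ j \<in> B" if "j < \<delta> - 1" for j
      using that by (auto simp: B_def setB_eq[OF \<alpha>0 h] g_def)
    show "(\<Sum>i<n. x i * b ^ i) = 0" if "x \<in> C" "b \<in> setprod A B" for x b
      using that by (simp add: C Z_def)
  qed
  obtain x where x: "x \<in> C" "x \<noteq> (\<lambda>_. 0)"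
  proof -
    have "card C > 1"
      using card_C one_less_power[OF q1 k(2)] by simp
    then have "\<not> C \<subseteq> {\<lambda>_. 0}"
      using card_mono[of "{\<lambda>_. 0}" C] by auto
    then show ?thesis
      using that by blast
  qed
  have zero: "(\<lambda>_. 0) \<in> C"
    by (simp add: C zero_in_subfield_Fq[OF assms(1)])
  \<comment> \<open>On a repair group meeting its support, a nonzero codeword has distance at least
    \<delta> from zero, so the group has at least \<delta> elements; its size is at most
    \<open>r + \<delta> - 1\<close>.\<close>
  have r: "r \<ge> 1"
  proof -
    obtain l where xl: "x l \<noteq> 0"
      using x(2) by auto
    then have "l < n"
      using x(1) by (auto simp: C) (metis not_le)
    from locality[OF this] obtain S where S: "S \<subseteq> {..<n}" "l \<in> S" "int (card S) \<le> r + int \<delta> - 1"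
      "\<forall>x\<in>C. \<forall>y\<in>C. puncture x S \<noteq> puncture y S \<longrightarrow>
             hamming_dist n (puncture x S) (puncture y S) \<ge> \<delta>"
      unfolding has_locality_def by blast
    have "puncture x S l \<noteq> puncture (\<lambda>_. 0) S l"
      using xl S(2) by (simp add: puncture_def)
    then have "\<delta> \<le> hamming_dist n (puncture x S) (puncture (\<lambda>_. 0) S)"
      using S(4) x(1) zero by metis
    also have "\<dots> \<le> card S"
      unfolding hamming_dist_def using S(1) finite_subset
      by (intro card_mono) (auto simp: puncture_def split: if_splits)
    finally show ?thesis
      using S(3) by linarith
  qed
  have lrc: "is_LRC n C r \<delta>"
    using r locality assms(6) by (simp add: is_LRC_def)
  have lower: "m + \<delta> - 1 \<le> min_dist n C"
  proof -
    obtain v w where vw: "v \<in> C" "w \<in> C" "v \<noteq> w" "hamming_dist n v w = min_dist n C"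
      using min_dist_attained[OF x(1) zero x(2)] by blast
    obtain l where l: "v l \<noteq> w l"
      using vw(3) by auto
    then have "l < n"
      using vw(1,2) by (auto simp: C) (metis not_le)
    \<comment> \<open>The long run of \<open>E\<close> supplies \<open>m + \<delta> - 2\<close>
      consecutive roots.\<close>
    moreover have "(\<Sum>i<n. (v i - w i) * (c * g ^ j) ^ i) = 0" if "j < m + \<delta> - 2" for j
    proof -
      have "c * g ^ j \<in> Z"
        using that assms(6) by (auto simp: Z E_def exponents_def)
      then show ?thesis
        using vw(1,2) by (simp add: C left_diff_distrib sum_subtractf)
    qed
    ultimately have "m + \<delta> - 2 + 1 \<le> card {i. i < n \<and> v i - w i \<noteq> 0}"
      using l by (intro BCH_bound[OF g n c0]) auto
    then show ?thesis
      using vw(4) assms(6) by (simp add: hamming_dist_def)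
  qed
  have "optimal_LRC n k C r \<delta> \<and> min_dist n C = m + \<delta> - 1"
    if ceil: "\<lceil>real k / real_of_int r\<rceil> = int s + 1"
  proof -
    have "int n - int k = int m - 1 + (int s + 1) * (int \<delta> - 1)"
    proof -
      have "int n - int k = int (card E)"
        using k(1,3) card_Z by linarith
      also have "\<dots> = int (m - 1) + (int s + 1) * int (\<delta> - 1)"
        unfolding E(2) by (simp add: distrib_right)
      also have "\<dots> = int m - 1 + (int s + 1) * (int \<delta> - 1)"
        using assms(6,9) by (simp add: of_nat_diff)
      finally show ?thesis .
    qed
    \<comment> \<open>The \<open>s\<close> short runs cancel against \<open>s\<close> copies of
      \<delta> - 1, leaving only the contribution of the long run.\<close>
    then have eq: "int n - int k - (\<lceil>real k / real_of_int r\<rceil> - 1) * (int \<delta> - 1) + 1 = int m + int \<delta> - 1"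
      unfolding ceil by (simp add: algebra_simps)
    have "int (min_dist n C) \<le> int m + int \<delta> - 1"
      unfolding eq[symmetric]
      using card_C q1 k(2)
      by (intro LRC_singleton_bound[OF lrc, where F = "subfield_Fq q"])
        (auto simp: card_subfield_Fq[OF assms(1,2)] C)
    then have "min_dist n C = m + \<delta> - 1"
      using lower by linarith
    then show ?thesis
      using lrc eq assms(6) by (simp add: optimal_LRC_def of_nat_diff)
  qed
  then show ?thesis
    using lrc card_C unfolding C_def Z_def A_def B_def by blast
qed

end
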